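(* Let $G$ be a compact connected Lie group with normalized Haar measure $dg$. For a finite-dimensional real or complex representation $\rho:G\to\mathrm{GL}(V)$, the operator $T(1)=\int_G\rho(g)\,dg:V\to V$ is the projection onto the subspace of invariants $V^G$ along the isotypic decomposition $V=\bigoplus_{[\tau]\in\hat G}V_{[\tau]}$; that is, $T(1)$ is the identity on $V^G$ and vanishes on $V_{[\tau]}$ for every non-trivial irreducible $\tau$.
   Context: $\hat G$ is the set of equivalence classes of irreducible representations of $G$ (over the field of $V$). The isotypic component $V_{[\tau]}$ is the sum of all irreducible subrepresentations of $V$ equivalent to $\tau$ ($\{0\}$ if there are none). The isotypic component of the trivial representation is $V^G=\{v\in V:\rho(g)v=v\ \forall g\in G\}$. *)

theory Defs
  imports
    "HOL-Analysis.Analysis"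
    "HOL-Algebra.Group_Action"
    "HOL-Library.Function_Algebras"
begin

section \<open>Lie groups\<close>

text \<open>
  \<open>\<real>\<^sup>n\<close> is the topology \<^const>\<open>Euclidean_space\<close> \<open>n\<close>, carried by the functions
  \<open>x :: nat \<Rightarrow> real\<close> with \<open>x i = 0\<close> for \<open>i \<ge> n\<close>, so that the dimension is a
  natural number and may be zero.  In what follows \<open>S\<close> is always an open subset of \<open>\<real>\<^sup>n\<close>; on such
  sets \<open>C\<^sup>k\<^sup>+\<^sup>1\<close> means continuous with all first partial derivatives existing and of class \<open>C\<^sup>k\<close>.
\<close>

primrec C_k_on :: "nat \<Rightarrow> nat \<Rightarrow> (nat \<Rightarrow> real) set \<Rightarrow> ((nat \<Rightarrow> real) \<Rightarrow> real) \<Rightarrow> bool" where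
  "C_k_on 0 n S f \<longleftrightarrow> continuous_map (subtopology (Euclidean_space n) S) euclideanreal f"
| "C_k_on (Suc k) n S f \<longleftrightarrow>
     continuous_map (subtopology (Euclidean_space n) S) euclideanreal f \<and>
     (\<forall>i<n. \<exists>f'. (\<forall>x\<in>S. ((\<lambda>t. f (x(i := t))) has_real_derivative f' x) (at (x i))) \<and>
                 C_k_on k n S f')"

definition smooth_into :: "nat \<Rightarrow> (nat \<Rightarrow> real) set \<Rightarrow> nat \<Rightarrow> ((nat \<Rightarrow> real) \<Rightarrow> nat \<Rightarrow> real) \<Rightarrow> bool" where
  "smooth_into n S m f \<longleftrightarrow> (\<forall>j<m. \<forall>k. C_k_on k n S (\<lambda>x. f x j))"

type_synonym 'a chart = "'a set \<times> ('a \<Rightarrow> nat \<Rightarrow> real)"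

locale smooth_manifold =
  fixes X :: "'a topology" and n :: nat and \<A> :: "'a chart set"
  assumes Hausdorff: "Hausdorff_space X"
    and second_countable: "second_countable X"
    and chart_domain: "(U, \<phi>) \<in> \<A> \<Longrightarrow> openin X U"
    and chart_range: "(U, \<phi>) \<in> \<A> \<Longrightarrow> openin (Euclidean_space n) (\<phi> ` U)"
    and chart_homeomorphism:
      "(U, \<phi>) \<in> \<A> \<Longrightarrow>
         homeomorphic_map (subtopology X U) (subtopology (Euclidean_space n) (\<phi> ` U)) \<phi>"
    and charts_cover: "(\<Union>(U, \<phi>)\<in>\<A>. U) = topspace X"
    and charts_compatible:
      "(U, \<phi>) \<in> \<A> \<Longrightarrow> (V, \<psi>) \<in> \<A> \<Longrightarrow>
         smooth_into n (\<phi> ` (U \<inter> V)) n (\<lambda>x. \<psi> (inv_into U \<phi> x))"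

definition smooth_map ::
  "'a topology \<Rightarrow> nat \<Rightarrow> 'a chart set \<Rightarrow> 'b topology \<Rightarrow> nat \<Rightarrow> 'b chart set \<Rightarrow> ('a \<Rightarrow> 'b) \<Rightarrow> bool" where
  "smooth_map X n \<A> Y m \<B> f \<longleftrightarrow>
     continuous_map X Y f \<and>
     (\<forall>(U, \<phi>)\<in>\<A>. \<forall>(V, \<psi>)\<in>\<B>.
        smooth_into n (\<phi> ` (U \<inter> f -` V)) m (\<lambda>x. \<psi> (f (inv_into U \<phi> x))))"

text \<open>The product chart of \<open>\<phi>\<close> and \<open>\<psi>\<close> concatenates \<open>\<phi> p \<in> \<real>\<^sup>n\<close> and \<open>\<psi> q \<in> \<real>\<^sup>m\<close> to a point of
  \<open>\<real>\<^sup>n\<^sup>+\<^sup>m\<close>.\<close>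

definition prod_atlas :: "nat \<Rightarrow> 'a chart set \<Rightarrow> 'b chart set \<Rightarrow> ('a \<times> 'b) chart set" where
  "prod_atlas n \<A> \<B> =
     {(U \<times> V, \<lambda>(p, q) i. if i < n then \<phi> p i else \<psi> q (i - n)) | U \<phi> V \<psi>.
        (U, \<phi>) \<in> \<A> \<and> (V, \<psi>) \<in> \<B>}"

locale lie_group = group G + smooth_manifold X n \<A>
  for G (structure) and X n \<A> +
  assumes topspace_eq: "topspace X = carrier G"
    and smooth_mult:
      "smooth_map (prod_topology X X) (n + n) (prod_atlas n \<A> \<A>) X n \<A> (\<lambda>(g, h). g \<otimes> h)"
    and smooth_inv: "smooth_map X n \<A> X n \<A> (\<lambda>g. inv g)"

text \<open>Normalized Haar measure of a compact Lie group \<open>G\<close>: the left-invariant Borel probability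
  measure.  Regularity is automatic, as \<open>G\<close> is compact and metrizable.\<close>

definition normalized_haar_measure ::
  "('g, 'm) monoid_scheme \<Rightarrow> 'g topology \<Rightarrow> 'g measure \<Rightarrow> bool" where
  "normalized_haar_measure G X \<mu> \<longleftrightarrow>
     space \<mu> = carrier G \<and>
     sets \<mu> = sigma_sets (carrier G) {U. openin X U} \<and>
     emeasure \<mu> (carrier G) = 1 \<and>
     (\<forall>g\<in>carrier G. \<forall>A\<in>sets \<mu>. emeasure \<mu> (g <#\<^bsub>G\<^esub> A) = emeasure \<mu> A)"

section \<open>Finite-dimensional representations\<close>

text \<open>
  The ground field is \<open>'k :: real_normed_field\<close>; its models are, by Gelfand-Mazur, exactly \<open>\<real>\<close> and
  \<open>\<complex>\<close>.  A vector space over \<open>'k\<close> is a subspace \<open>V\<close> of a type \<open>'v\<close> with scalar multiplication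
  \<open>smul\<close>.  Where \<open>V\<close>-valued functions are integrated, \<open>'v\<close> is a Euclidean space and \<open>smul\<close> extends \<open>scaleR\<close>,
  so that \<open>V\<close> carries its canonical topology; the inner product of \<open>'v\<close> plays no other role.
\<close>

definition linear_map_on ::
  "('k \<Rightarrow> 'v \<Rightarrow> 'v::ab_group_add) \<Rightarrow> 'v set \<Rightarrow> ('k \<Rightarrow> 'w \<Rightarrow> 'w::ab_group_add) \<Rightarrow> 'w set \<Rightarrow>
   ('v \<Rightarrow> 'w) \<Rightarrow> bool" where
  "linear_map_on scaleV V scaleW W f \<longleftrightarrow>
     f \<in> V \<rightarrow> W \<and>
     (\<forall>u\<in>V. \<forall>v\<in>V. f (u + v) = f u + f v) \<and>
     (\<forall>c. \<forall>v\<in>V. f (scaleV c v) = scaleW c (f v))"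

text \<open>A continuous homomorphism \<open>\<rho> : G \<rightarrow> GL(V)\<close>; on a finite-dimensional \<open>V\<close>, continuity into
  \<open>GL(V)\<close> is continuity of all orbit maps \<open>g \<mapsto> \<rho>(g)v\<close>.  (\<open>group_action\<close> makes each \<open>\<rho> g\<close> a
  bijection of \<open>V\<close> that is \<open>undefined\<close> outside \<open>V\<close>.)\<close>

locale fd_representation = vector_space smul + group_action G V \<rho>
  for G :: "('g, 'm) monoid_scheme" (structure)
    and X :: "'g topology"
    and smul :: "'k::real_normed_field \<Rightarrow> 'v::{ab_group_add, topological_space} \<Rightarrow> 'v"
    and V :: "'v set"
    and \<rho> :: "'g \<Rightarrow> 'v \<Rightarrow> 'v" +
  assumes finite_dimensional: "\<exists>B. finite B \<and> V = span B"
    and linear_action: "g \<in> carrier G \<Longrightarrow> linear_map_on smul V smul V (\<rho> g)"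
    and continuous_orbit: "v \<in> V \<Longrightarrow> continuous_map X euclidean (\<lambda>g. \<rho> g v)"

definition invariant_vectors :: "('g, 'm) monoid_scheme \<Rightarrow> 'v set \<Rightarrow> ('g \<Rightarrow> 'v \<Rightarrow> 'v) \<Rightarrow> 'v set" where
  "invariant_vectors G V \<rho> = {v \<in> V. \<forall>g\<in>carrier G. \<rho> g v = v}"

definition invariant_subspace ::
  "('g, 'm) monoid_scheme \<Rightarrow> ('k::field \<Rightarrow> 'v \<Rightarrow> 'v::ab_group_add) \<Rightarrow> 'v set \<Rightarrow>
   ('g \<Rightarrow> 'v \<Rightarrow> 'v) \<Rightarrow> 'v set \<Rightarrow> bool" where
  "invariant_subspace G smul V \<rho> W \<longleftrightarrow>
     module.subspace smul W \<and> W \<subseteq> V \<and> (\<forall>g\<in>carrier G. \<rho> g ` W \<subseteq> W)"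

definition irreducible_representation ::
  "('g, 'm) monoid_scheme \<Rightarrow> 'g topology \<Rightarrow>
   ('k::real_normed_field \<Rightarrow> 'v \<Rightarrow> 'v::{ab_group_add, topological_space}) \<Rightarrow> 'v set \<Rightarrow>
   ('g \<Rightarrow> 'v \<Rightarrow> 'v) \<Rightarrow> bool" where
  "irreducible_representation G X smul V \<rho> \<longleftrightarrow>
     fd_representation G X smul V \<rho> \<and> V \<noteq> {0} \<and>
     (\<forall>W. invariant_subspace G smul V \<rho> W \<longrightarrow> W = {0} \<or> W = V)"

definition equivalent_representations ::
  "('g, 'm) monoid_scheme \<Rightarrow>
   ('k \<Rightarrow> 'v \<Rightarrow> 'v::ab_group_add) \<Rightarrow> 'v set \<Rightarrow> ('g \<Rightarrow> 'v \<Rightarrow> 'v) \<Rightarrow>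
   ('k \<Rightarrow> 'w \<Rightarrow> 'w::ab_group_add) \<Rightarrow> 'w set \<Rightarrow> ('g \<Rightarrow> 'w \<Rightarrow> 'w) \<Rightarrow> bool" where
  "equivalent_representations G scaleV V \<rho> scaleW W \<sigma> \<longleftrightarrow>
     (\<exists>f. linear_map_on scaleV V scaleW W f \<and> bij_betw f V W \<and>
          (\<forall>g\<in>carrier G. \<forall>v\<in>V. f (\<rho> g v) = \<sigma> g (f v)))"

section \<open>The dual object and isotypic components\<close>

text \<open>
  Every finite-dimensional representation over \<open>'k\<close> is equivalent to one on a coordinate space
  \<open>'k\<^sup>d\<close>, so the dual object of \<open>G\<close> is the set of classes of irreducible representations on the spaces \<open>'k\<^sup>d\<close>.
  As above, \<open>'k\<^sup>d\<close> consists of the sequences vanishing from index \<open>d\<close> on; it carries the product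
  topology.
\<close>

definition coord_smul :: "'k::real_normed_field \<Rightarrow> (nat \<Rightarrow> 'k) \<Rightarrow> nat \<Rightarrow> 'k" where
  "coord_smul c x = (\<lambda>i. c * x i)"

definition coord_space :: "nat \<Rightarrow> (nat \<Rightarrow> 'k::real_normed_field) set" where
  "coord_space d = {x. \<forall>i\<ge>d. x i = 0}"

type_synonym ('g, 'k) coord_rep = "(nat \<Rightarrow> 'k) set \<times> ('g \<Rightarrow> (nat \<Rightarrow> 'k) \<Rightarrow> nat \<Rightarrow> 'k)"

definition irreps ::
  "('g, 'm) monoid_scheme \<Rightarrow> 'g topology \<Rightarrow> ('g, 'k::real_normed_field) coord_rep set" where
  "irreps G X =
     {(U, \<tau>). (\<exists>d. U = coord_space d) \<and> irreducible_representation G X coord_smul U \<tau>}"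

definition irrep_equiv ::
  "('g, 'm) monoid_scheme \<Rightarrow> 'g topology \<Rightarrow> ('g, 'k::real_normed_field) coord_rep rel" where
  "irrep_equiv G X =
     {((U, \<tau>), (U', \<tau>')). (U, \<tau>) \<in> irreps G X \<and> (U', \<tau>') \<in> irreps G X \<and>
        equivalent_representations G coord_smul U \<tau> coord_smul U' \<tau>'}"

definition dual_object ::
  "('g, 'm) monoid_scheme \<Rightarrow> 'g topology \<Rightarrow> ('g, 'k::real_normed_field) coord_rep set set" where
  "dual_object G X = irreps G X // irrep_equiv G X"

definition trivial_class ::
  "('g, 'm) monoid_scheme \<Rightarrow> 'g topology \<Rightarrow> ('g, 'k::real_normed_field) coord_rep set" where
  "trivial_class G X = irrep_equiv G X `` {(coord_space 1, \<lambda>g. \<lambda>x\<in>coord_space 1. x)}"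

definition isotypic_component ::
  "('g, 'm) monoid_scheme \<Rightarrow> 'g topology \<Rightarrow>
   ('k::real_normed_field \<Rightarrow> 'v \<Rightarrow> 'v::{ab_group_add, topological_space}) \<Rightarrow> 'v set \<Rightarrow>
   ('g \<Rightarrow> 'v \<Rightarrow> 'v) \<Rightarrow> ('g, 'k) coord_rep set \<Rightarrow> 'v set" where
  "isotypic_component G X smul V \<rho> c =
     module.span smul
       (\<Union>{W. invariant_subspace G smul V \<rho> W \<and>
             irreducible_representation G X smul W (\<lambda>g. restrict (\<rho> g) W) \<and>
             (\<exists>(U, \<tau>)\<in>c. equivalent_representations G
                smul W (\<lambda>g. restrict (\<rho> g) W) coord_smul U \<tau>)})"

definition is_direct_sum ::
  "('k::field \<Rightarrow> 'v \<Rightarrow> 'v::ab_group_add) \<Rightarrow> 'v set \<Rightarrow> 'i set \<Rightarrow> ('i \<Rightarrow> 'v set) \<Rightarrow> bool" where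
  "is_direct_sum smul V I F \<longleftrightarrow>
     (\<forall>i\<in>I. module.subspace smul (F i) \<and> F i \<subseteq> V) \<and>
     (\<forall>v\<in>V. \<exists>!f. (\<forall>i\<in>I. f i \<in> F i) \<and> (\<forall>i. i \<notin> I \<longrightarrow> f i = 0) \<and>
                  finite {i. f i \<noteq> 0} \<and> v = (\<Sum>i | f i \<noteq> 0. f i))"

text \<open>The operator \<open>T(1) = \<integral>\<^sub>G \<rho>(g) dg\<close>, integrated pointwise in the Bochner sense.\<close>

definition averaging_operator ::
  "'g measure \<Rightarrow> ('g \<Rightarrow> 'v \<Rightarrow> 'v::euclidean_space) \<Rightarrow> 'v \<Rightarrow> 'v" where
  "averaging_operator \<mu> \<rho> v = (\<integral>g. \<rho> g v \<partial>\<mu>)"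

end

theory Submission
  imports Defs
begin

text \<open>
  Averaging \<open>\<rho>(g) p \<rho>(g)\<^sup>-\<^sup>1\<close> over Haar measure turns a linear projection \<open>p\<close> onto an invariant
  subspace \<open>W\<close> into an equivariant one.  Its kernel is an invariant complement of \<open>W\<close>, so \<open>V\<close> is
  spanned by irreducible subspaces; and if \<open>W\<close> is irreducible and contained in a sum of irreducible
  subspaces, the projection does not vanish on one of them, which by Schur's lemma is equivalent to
  \<open>W\<close>.  Hence an irreducible subspace of \<open>V\<^sub>c \<inter> (\<Sum>d\<noteq>c. V\<^sub>d)\<close> would belong to two classes, and the
  isotypic decomposition is direct.  Finally \<open>T(1)\<close> maps an irreducible \<open>W\<close> into the invariant
  subspace \<open>W \<inter> V\<^sup>G\<close>, which is zero unless \<open>W\<close> is trivial.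
\<close>

section \<open>Subrepresentations and equivalence\<close>

text \<open>Two mismatches shape the proof. First, \<open>\<rho> g\<close> is linear on
  \<open>V\<close> only and \<open>undefined\<close> elsewhere, whereas Bochner integrals commute
  with bounded linear maps of the whole space. Every exchange of \<open>\<rho> h\<close> with an
  integral therefore goes through a linear projection of the ambient space onto \<open>V\<close>,
  which fixes all the values in question. Second, the dual object consists of classes of
  representations on the spaces \<open>'k\<^sup>d\<close>, whereas subrepresentations are subspaces
  of \<open>V\<close>. Each irreducible subspace is therefore copied onto coordinates, and
  continuity has to be checked again in the product topology. Real and complex scalars are treated
  at once: the part of Schur's lemma that is applied, bijectivity of a nonzero equivariant map
  between irreducibles, involves no eigenvalues.\<close>

lemma group_actionI:
  fixes G (structure)
  assumes "group G"
    and ext: "\<And>g. g \<in> carrier G \<Longrightarrow> \<phi> g \<in> extensional E"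
    and closed: "\<And>g x. g \<in> carrier G \<Longrightarrow> x \<in> E \<Longrightarrow> \<phi> g x \<in> E"
    and one: "\<And>x. x \<in> E \<Longrightarrow> \<phi> \<one> x = x"
    and mult: "\<And>g h x. g \<in> carrier G \<Longrightarrow> h \<in> carrier G \<Longrightarrow> x \<in> E \<Longrightarrow> \<phi> (g \<otimes> h) x = \<phi> g (\<phi> h x)"
  shows "group_action G E \<phi>"
proof -
  interpret group G by fact
  have Bij: "\<phi> g \<in> Bij E" if g: "g \<in> carrier G" for g
  proof -
    have "bij_betw (\<phi> g) E E"
    proof (rule bij_betw_byWitness[where f' = "\<phi> (inv g)"])
      show "\<forall>a\<in>E. \<phi> (inv g) (\<phi> g a) = a"
        using g mult[of "inv g" g] one by simp
      show "\<forall>a\<in>E. \<phi> g (\<phi> (inv g) a) = a"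
        using g mult[of g "inv g"] one by simp
    qed (use g closed in auto)
    then show ?thesis using ext[OF g] by (simp add: Bij_def)
  qed
  have "\<phi> (g \<otimes> h) = \<phi> g \<otimes>\<^bsub>BijGroup E\<^esub> \<phi> h" if "g \<in> carrier G" "h \<in> carrier G" for g h
  proof (rule extensionalityI[where A = E])
    show "\<phi> (g \<otimes> h) \<in> extensional E" using ext that by simp
    show "(\<phi> g \<otimes>\<^bsub>BijGroup E\<^esub> \<phi> h) \<in> extensional E" using Bij that by (simp add: BijGroup_def)
    show "\<phi> (g \<otimes> h) x = (\<phi> g \<otimes>\<^bsub>BijGroup E\<^esub> \<phi> h) x" if "x \<in> E" for x
      using that Bij mult \<open>g \<in> carrier G\<close> \<open>h \<in> carrier G\<close> by (simp add: BijGroup_def compose_eq)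
  qed
  then have "group_hom G (BijGroup E) \<phi>"
    using Bij by (intro group_hom.intro group_BijGroup group_hom_axioms.intro \<open>group G\<close>)
      (auto simp: hom_def BijGroup_def)
  then show ?thesis by (rule group_action.intro)
qed

context fd_representation
begin

lemma group_G: "group G"
  using group_hom group_hom.axioms(1) by blast

lemma subspace_V: "subspace V"
  using finite_dimensional by auto

lemma action_closed: "g \<in> carrier G \<Longrightarrow> v \<in> V \<Longrightarrow> \<rho> g v \<in> V"
  using element_image by blast

lemma action_one: "v \<in> V \<Longrightarrow> \<rho> \<one> v = v"
  by (metis id_eq_one restrict_apply')

lemma action_add: "g \<in> carrier G \<Longrightarrow> u \<in> V \<Longrightarrow> v \<in> V \<Longrightarrow> \<rho> g (u + v) = \<rho> g u + \<rho> g v"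
  using linear_action by (auto simp: linear_map_on_def)

lemma action_scale: "g \<in> carrier G \<Longrightarrow> v \<in> V \<Longrightarrow> \<rho> g (smul c v) = smul c (\<rho> g v)"
  using linear_action by (auto simp: linear_map_on_def)

lemma invariant_subspace_V: "invariant_subspace G smul V \<rho> V"
  using subspace_V action_closed by (auto simp: invariant_subspace_def)

lemma finite_basis_exists:
  fixes U :: "'v set"
  assumes "subspace U" "U \<subseteq> V"
  shows "\<exists>B. finite B \<and> independent B \<and> U = span B"
proof -
  obtain B where B: "B \<subseteq> U" "independent B" "U \<subseteq> span B"
    using maximal_independent_subset by blast
  obtain C where C: "finite C" "V = span C" using finite_dimensional by blast
  have "finite B"
    using independent_span_bound[OF C(1) B(2)] B(1) assms(2) C(2) by auto
  moreover have "U = span B"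
    using B assms(1) span_minimal by blast
  ultimately show ?thesis using B by blast
qed

text \<open>The encoding forces \<open>restrict\<close>: a group action consists of bijections that
  are \<open>undefined\<close> off their carrier, which is now \<open>W\<close>.\<close>

lemma subrepresentation:
  assumes "invariant_subspace G smul V \<rho> W"
  shows "fd_representation G X smul W (\<lambda>g. restrict (\<rho> g) W)"
proof -
  have W: "subspace W" "W \<subseteq> V" and closed: "\<And>g w. g \<in> carrier G \<Longrightarrow> w \<in> W \<Longrightarrow> \<rho> g w \<in> W"
    using assms by (auto simp: invariant_subspace_def)
  have "group_action G W (\<lambda>g. restrict (\<rho> g) W)"
    using W closed action_one composition_rule
    by (intro group_actionI group_G) (auto simp: subset_iff)
  moreover have "fd_representation_axioms G X smul W (\<lambda>g. restrict (\<rho> g) W)"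
  proof
    show "\<exists>B. finite B \<and> W = span B"
      using finite_basis_exists[OF W] by blast
    show "linear_map_on smul W smul W (restrict (\<rho> g) W)" if "g \<in> carrier G" for g
      using that closed W action_add action_scale
      by (auto simp: linear_map_on_def subset_iff subspace_add subspace_scale)
    show "continuous_map X euclidean (\<lambda>g. restrict (\<rho> g) W v)" if "v \<in> W" for v
      using that W continuous_orbit[of v] by auto
  qed
  ultimately show ?thesis
    by (intro fd_representation.intro vector_space_axioms)
qed

lemma invariant_subspace_restrict_iff:
  assumes "invariant_subspace G smul V \<rho> W"
  shows "invariant_subspace G smul W (\<lambda>g. restrict (\<rho> g) W) W' \<longleftrightarrow>
    invariant_subspace G smul V \<rho> W' \<and> W' \<subseteq> W"
proof -
  have "restrict (\<rho> g) W ` W' = \<rho> g ` W'" if "W' \<subseteq> W" for g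
    using that by (intro image_cong) auto
  then show ?thesis
    using assms unfolding invariant_subspace_def by (metis subset_trans)
qed

end

abbreviation irreducible_subspace ::
  "('g, 'm) monoid_scheme \<Rightarrow> 'g topology \<Rightarrow>
   ('k::real_normed_field \<Rightarrow> 'v \<Rightarrow> 'v::{ab_group_add, topological_space}) \<Rightarrow> 'v set \<Rightarrow>
   ('g \<Rightarrow> 'v \<Rightarrow> 'v) \<Rightarrow> 'v set \<Rightarrow> bool" where
  "irreducible_subspace G X smul V \<rho> W \<equiv>
     invariant_subspace G smul V \<rho> W \<and>
     irreducible_representation G X smul W (\<lambda>g. restrict (\<rho> g) W)"

text \<open>Invariance inside \<open>W\<close> and inside \<open>V\<close> agree for subsets of
  \<open>W\<close>, so irreducibility is minimality among the nonzero invariant subspaces of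
  \<open>V\<close>. Arguments about kernels, images and intersections can then stay in
  \<open>V\<close>.\<close>

lemma (in fd_representation) irreducible_subspace_iff:
  "irreducible_subspace G X smul V \<rho> W \<longleftrightarrow>
     invariant_subspace G smul V \<rho> W \<and> W \<noteq> {0} \<and>
     (\<forall>W'. invariant_subspace G smul V \<rho> W' \<longrightarrow> W' \<subseteq> W \<longrightarrow> W' = {0} \<or> W' = W)"
  using subrepresentation invariant_subspace_restrict_iff[of W]
  by (auto simp: irreducible_representation_def)

lemma linear_map_on_inv_into:
  assumes "vector_space s" "module.subspace s V" "linear_map_on s V t W f" "bij_betw f V W"
  shows "linear_map_on t W s V (inv_into V f)"
proof -
  interpret vector_space s by fact
  have inj: "inj_on f V" and fV: "f ` V = W" using assms(4) by (auto simp: bij_betw_def)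
  have "inv_into V f (x + y) = inv_into V f x + inv_into V f y" if "x \<in> W" "y \<in> W" for x y
    using that assms(2,3) inj unfolding fV[symmetric] linear_map_on_def
    by (auto simp: inv_into_f_f inv_into_f_eq subspace_add)
  moreover have "inv_into V f (t c x) = s c (inv_into V f x)" if "x \<in> W" for c x
    using that assms(2,3) inj unfolding fV[symmetric] linear_map_on_def
    by (auto simp: inv_into_f_f inv_into_f_eq subspace_scale)
  moreover have "inv_into V f x \<in> V" if "x \<in> W" for x
    using that fV inv_into_into by metis
  ultimately show ?thesis by (auto simp: linear_map_on_def)
qed

section \<open>Equivalence of representations and transport along linear bijections\<close>

lemma equivalent_representations_refl:
  "equivalent_representations G s V \<rho> s V \<rho>"
  unfolding equivalent_representations_def
  by (rule exI[of _ id]) (auto simp: linear_map_on_def)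

text \<open>Only the source is assumed to be a representation: its closure under sums, scalars and
  the action is what makes the inverse linear and equivariant.\<close>

lemma equivalent_representations_sym:
  assumes "fd_representation G X s V \<rho>" "equivalent_representations G s V \<rho> t W \<sigma>"
  shows "equivalent_representations G t W \<sigma> s V \<rho>"
proof -
  interpret fd_representation G X s V \<rho> by fact
  obtain f where f: "linear_map_on s V t W f" "bij_betw f V W"
    "\<And>g v. g \<in> carrier G \<Longrightarrow> v \<in> V \<Longrightarrow> f (\<rho> g v) = \<sigma> g (f v)"
    using assms(2) by (auto simp: equivalent_representations_def)
  have inj: "inj_on f V" and fV: "f ` V = W" using f(2) by (auto simp: bij_betw_def)
  have "inv_into V f (\<sigma> g w) = \<rho> g (inv_into V f w)" if "g \<in> carrier G" "w \<in> W" for g w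
    using that inj f(3) action_closed unfolding fV[symmetric]
    by (auto simp: inv_into_f_f simp flip: f(3))
  then show ?thesis
    unfolding equivalent_representations_def
    using linear_map_on_inv_into[OF vector_space_axioms subspace_V f(1,2)] bij_betw_inv_into[OF f(2)]
    by blast
qed

lemma equivalent_representations_trans:
  assumes "equivalent_representations G s V \<rho> t W \<sigma>" "equivalent_representations G t W \<sigma> r U \<tau>"
  shows "equivalent_representations G s V \<rho> r U \<tau>"
proof -
  obtain f where f: "linear_map_on s V t W f" "bij_betw f V W"
    "\<And>g v. g \<in> carrier G \<Longrightarrow> v \<in> V \<Longrightarrow> f (\<rho> g v) = \<sigma> g (f v)"
    using assms(1) by (auto simp: equivalent_representations_def)
  obtain h where h: "linear_map_on t W r U h" "bij_betw h W U"
    "\<And>g v. g \<in> carrier G \<Longrightarrow> v \<in> W \<Longrightarrow> h (\<sigma> g v) = \<tau> g (h v)"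
    using assms(2) by (auto simp: equivalent_representations_def)
  have "f v \<in> W" if "v \<in> V" for v using f(1) that by (auto simp: linear_map_on_def)
  then show ?thesis
    unfolding equivalent_representations_def using f h bij_betw_trans[OF f(2) h(2)]
    by (intro exI[of _ "h \<circ> f"]) (auto simp: linear_map_on_def)
qed

text \<open>\<open>linear_map_on\<close> has no clause about zero; scaling by the scalar 0 supplies
  it.\<close>

lemma linear_map_on_zero:
  assumes "vector_space s" "module.subspace s V" "vector_space t" "linear_map_on s V t W f"
  shows "f 0 = 0"
proof -
  interpret A: vector_space s by fact
  interpret B: vector_space t by fact
  have "f (s 0 0) = t 0 (f 0)"
    using assms(4) A.subspace_0[OF assms(2)] unfolding linear_map_on_def by blast
  then show ?thesis by simp
qed

lemma (in fd_representation) action_zero: "g \<in> carrier G \<Longrightarrow> \<rho> g 0 = 0"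
  by (rule linear_map_on_zero[OF vector_space_axioms subspace_V vector_space_axioms linear_action])

lemma linear_map_on_image_subspace:
  assumes "vector_space s" "module.subspace s V" "vector_space t" "linear_map_on s V t W f"
    and "module.subspace s U" "U \<subseteq> V"
  shows "module.subspace t (f ` U)"
proof -
  interpret A: vector_space s by fact
  interpret B: vector_space t by fact
  have add: "\<And>u v. u \<in> V \<Longrightarrow> v \<in> V \<Longrightarrow> f u + f v = f (u + v)"
    and scale: "\<And>c v. v \<in> V \<Longrightarrow> t c (f v) = f (s c v)"
    using assms(4) by (auto simp: linear_map_on_def)
  show ?thesis
  proof (rule B.subspaceI)
    show "0 \<in> f ` U"
      using linear_map_on_zero[OF assms(1-4)] A.subspace_0[OF assms(5)] by force
    show "x + y \<in> f ` U" if "x \<in> f ` U" "y \<in> f ` U" for x y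
      using that assms(6) A.subspace_add[OF assms(5)] by (auto simp: add subset_iff)
    show "t c x \<in> f ` U" if "x \<in> f ` U" for c x
      using that assms(6) A.subspace_scale[OF assms(5)] by (auto simp: scale subset_iff)
  qed
qed

text \<open>The equivalence is reversed first, so that \<open>f\<close> carries an invariant
  subspace of \<open>W\<close> into \<open>V\<close>, where irreducibility decides what it is;
  injectivity of \<open>f\<close> brings the answer back.\<close>

lemma irreducible_representation_equivalent:
  assumes irr: "irreducible_representation G X s V \<rho>"
    and "fd_representation G X t W \<sigma>" "equivalent_representations G s V \<rho> t W \<sigma>"
  shows "irreducible_representation G X t W \<sigma>"
proof -
  have "fd_representation G X s V \<rho>" using irr by (simp add: irreducible_representation_def)
  then interpret A: fd_representation G X s V \<rho> .
  interpret B: fd_representation G X t W \<sigma> by fact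
  obtain f where f: "linear_map_on t W s V f" "bij_betw f W V"
    "\<And>g w. g \<in> carrier G \<Longrightarrow> w \<in> W \<Longrightarrow> f (\<sigma> g w) = \<rho> g (f w)"
    using equivalent_representations_sym[OF A.fd_representation_axioms assms(3)]
    by (auto simp: equivalent_representations_def)
  note f0 = linear_map_on_zero[OF B.vector_space_axioms B.subspace_V A.vector_space_axioms f(1)]
  have inj: "inj_on f W" and fW: "f ` W = V" using f(2) by (auto simp: bij_betw_def)
  have W0: "W \<noteq> {0}" using irr f0 fW by (auto simp: irreducible_representation_def)
  have "U = {0} \<or> U = W" if U: "invariant_subspace G t W \<sigma> U" for U
  proof -
    have UW: "B.subspace U" "U \<subseteq> W" "\<And>g. g \<in> carrier G \<Longrightarrow> \<sigma> g ` U \<subseteq> U"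
      using U by (auto simp: invariant_subspace_def)
    have "A.subspace (f ` U)"
      by (rule linear_map_on_image_subspace[OF B.vector_space_axioms B.subspace_V
            A.vector_space_axioms f(1) UW(1,2)])
    moreover have "\<rho> g ` f ` U \<subseteq> f ` U" if "g \<in> carrier G" for g
    proof safe
      fix u assume "u \<in> U"
      then have "\<rho> g (f u) = f (\<sigma> g u)" "\<sigma> g u \<in> U"
        using UW(2) UW(3)[OF that] f(3)[OF that] by auto
      then show "\<rho> g (f u) \<in> f ` U" by simp
    qed
    ultimately have "invariant_subspace G s V \<rho> (f ` U)"
      using UW fW by (auto simp: invariant_subspace_def)
    then have "f ` U = {0} \<or> f ` U = V"
      using irr by (auto simp: irreducible_representation_def)
    moreover have "{0} = f ` {0}" using f0 by simp
    ultimately have "f ` U = f ` {0} \<or> f ` U = f ` W" using fW by metis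
    then show ?thesis
      using inj_on_image_eq_iff[OF inj] UW(2) B.subspace_0[OF B.subspace_V] by blast
  qed
  with W0 show ?thesis
    using assms(2) by (auto simp: irreducible_representation_def)
qed

text \<open>Conjugation by \<open>f\<close> defines the action on \<open>U\<close>, and everything
  algebraic moves along. The map \<open>f\<close> is not assumed continuous, so continuity of the
  conjugated orbits is left to the caller.\<close>

lemma (in fd_representation) transport:
  assumes "vector_space t" "linear_map_on smul V t U f" "bij_betw f V U"
    and cont: "\<And>u. u \<in> U \<Longrightarrow> continuous_map X euclidean (\<lambda>g. f (\<rho> g (inv_into V f u)))"
  defines "\<tau> \<equiv> \<lambda>g. \<lambda>u\<in>U. f (\<rho> g (inv_into V f u))"
  shows "fd_representation G X t U \<tau>" "equivalent_representations G smul V \<rho> t U \<tau>"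
proof -
  interpret T: vector_space t by fact
  have inj: "inj_on f V" and fV: "f ` V = U" using assms(3) by (auto simp: bij_betw_def)
  have f: "\<And>u v. u \<in> V \<Longrightarrow> v \<in> V \<Longrightarrow> f (u + v) = f u + f v"
    "\<And>c v. v \<in> V \<Longrightarrow> f (smul c v) = t c (f v)"
    using assms(2) by (auto simp: linear_map_on_def)
  have \<tau>: "\<tau> g (f v) = f (\<rho> g v)" if "v \<in> V" for g v
    using that inj fV by (auto simp: \<tau>_def)
  show "fd_representation G X t U \<tau>"
  proof (intro fd_representation.intro fd_representation_axioms.intro)
    show "vector_space t" by fact
    show "group_action G U \<tau>"
    proof (intro group_actionI group_G)
      show "\<tau> g \<in> extensional U" for g by (simp add: \<tau>_def)
      show "\<tau> g x \<in> U" if "g \<in> carrier G" "x \<in> U" for g x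
        using that unfolding fV[symmetric] by (auto simp: \<tau> action_closed)
      show "\<tau> \<one> x = x" if "x \<in> U" for x
        using that unfolding fV[symmetric] by (auto simp: \<tau> action_one)
      show "\<tau> (g \<otimes> h) x = \<tau> g (\<tau> h x)" if "g \<in> carrier G" "h \<in> carrier G" "x \<in> U" for g h x
        using that unfolding fV[symmetric] by (auto simp: \<tau> action_closed composition_rule)
    qed
    obtain B where B: "finite B" "V = span B" using finite_dimensional by blast
    then have BV: "B \<subseteq> V" using span_superset by blast
    have "U = T.span (f ` B)"
    proof
      \<comment> \<open>Membership in \<open>V\<close> is carried through the induction because
        \<open>f\<close> is additive only there.\<close>
      have "v \<in> V \<and> f v \<in> T.span (f ` B)" if "v \<in> span B" for v
        using that
      proof (induction rule: span_induct_alt)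
        case base
        then show ?case
          using linear_map_on_zero[OF vector_space_axioms subspace_V T.vector_space_axioms assms(2)]
          by (simp add: T.span_zero subspace_0[OF subspace_V])
      next
        case (step c x y)
        then show ?case
          using BV T.span_base[of "f x" "f ` B"]
          by (auto simp: f subset_iff subspace_V subspace_add subspace_scale T.span_add T.span_scale)
      qed
      then show "U \<subseteq> T.span (f ` B)" using fV B by blast
      have "T.subspace U"
        using linear_map_on_image_subspace[OF vector_space_axioms subspace_V T.vector_space_axioms
            assms(2) subspace_V] fV by simp
      then show "T.span (f ` B) \<subseteq> U" using BV fV by (intro T.span_minimal) auto
    qed
    then show "\<exists>B. finite B \<and> U = T.span B" using B(1) by blast
    show "linear_map_on t U t U (\<tau> g)" if "g \<in> carrier G" for g
      using that \<tau> unfolding linear_map_on_def fV[symmetric]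
      by (auto simp: action_closed action_add action_scale subspace_V subspace_add subspace_scale
          simp flip: f)
    show "continuous_map X euclidean (\<lambda>g. \<tau> g u)" if "u \<in> U" for u
      using cont[OF that] that by (simp add: \<tau>_def)
  qed
  show "equivalent_representations G smul V \<rho> t U \<tau>"
    unfolding equivalent_representations_def using assms(2,3) \<tau> by auto
qed

section \<open>Linear projections and coordinate maps\<close>

lemma (in vector_space) exists_projection:
  assumes "subspace W"
  shows "\<exists>p. Vector_Spaces.linear scale scale p \<and> range p \<subseteq> W \<and> (\<forall>w\<in>W. p w = w)"
proof -
  interpret vector_space_pair scale scale by unfold_locales
  show ?thesis
    using linear_exists_left_inverse_on[OF linear_id assms] by auto
qed

lemma vector_space_coord_smul: "vector_space (coord_smul :: 'k::real_normed_field \<Rightarrow> _)"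
  by unfold_locales (auto simp: coord_smul_def algebra_simps)

lemma exists_coordinates:
  fixes s :: "'k::real_normed_field \<Rightarrow> 'v \<Rightarrow> 'v::ab_group_add"
  assumes "vector_space s" "finite B" "\<not> module.dependent s B"
  shows "\<exists>\<phi>. Vector_Spaces.linear s coord_smul \<phi> \<and>
    bij_betw \<phi> (module.span s B) (coord_space (card B))"
proof -
  interpret vector_space s by fact
  interpret C: vector_space "coord_smul :: 'k \<Rightarrow> _" by (rule vector_space_coord_smul)
  \<comment> \<open>Coordinates are taken in a basis of the whole space. This makes the map linear
    everywhere, so that its coordinates will be bounded linear; on \<open>span B\<close> they are
    the coordinates with respect to \<open>B\<close>.\<close>
  define E where "E = extend_basis B"
  have E: "independent E" "B \<subseteq> E" "span E = UNIV"
    unfolding E_def using assms(3) independent_extend_basis extend_basis_superset span_extend_basis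
    by blast+
  obtain b where b: "bij_betw b {..<card B} B"
    using ex_bij_betw_nat_finite[OF assms(2)] by (auto simp: atLeast0LessThan)
  then have bB: "i < card B \<Longrightarrow> b i \<in> B" for i by (auto simp: bij_betw_def)
  define \<phi> where "\<phi> v = (\<lambda>i. if i < card B then representation E v (b i) else 0)" for v
  have lin: "Vector_Spaces.linear s coord_smul \<phi>"
    by unfold_locales
      (auto simp: \<phi>_def coord_smul_def fun_eq_iff E representation_add representation_scale)
  have expand: "(\<Sum>i<card B. s (\<phi> v i) (b i)) = v" if "v \<in> span B" for v
  proof -
    have "(\<Sum>i<card B. s (\<phi> v i) (b i)) = (\<Sum>i<card B. s (representation B v (b i)) (b i))"
      using representation_extend[OF E(1) that E(2)] by (simp add: \<phi>_def)
    also have "\<dots> = (\<Sum>x\<in>B. s (representation B v x) x)"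
      by (rule sum.reindex_bij_betw[OF b])
    also have "\<dots> = v"
      using sum_representation_eq[OF assms(3) that assms(2)] by simp
    finally show ?thesis .
  qed
  have coords: "\<phi> (\<Sum>i<card B. s (x i) (b i)) = x" if "x \<in> coord_space (card B)" for x
  proof
    fix j
    show "\<phi> (\<Sum>i<card B. s (x i) (b i)) j = x j"
    proof (cases "j < card B")
      case True
      have "\<phi> (\<Sum>i<card B. s (x i) (b i)) j = (\<Sum>i<card B. x i * representation E (b i) (b j))"
        using True by (simp add: \<phi>_def representation_sum E representation_scale)
      also have "\<dots> = (\<Sum>i<card B. if i = j then x i else 0)"
      proof (rule sum.cong)
        fix i assume "i \<in> {..<card B}"
        then have "representation E (b i) (b j) = (if i = j then 1 else 0)"
          using representation_basis[OF E(1) subsetD[OF E(2) bB]] True b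
          by (auto simp: bij_betw_def inj_on_def)
        then show "x i * representation E (b i) (b j) = (if i = j then x i else 0)" by simp
      qed simp
      also have "\<dots> = x j" using True by simp
      finally show ?thesis .
    next
      case False
      then show ?thesis using that by (simp add: \<phi>_def coord_space_def)
    qed
  qed
  have "bij_betw \<phi> (span B) (coord_space (card B))"
  proof (rule bij_betw_byWitness[where f' = "\<lambda>x. \<Sum>i<card B. s (x i) (b i)"])
    show "\<phi> ` span B \<subseteq> coord_space (card B)" by (auto simp: \<phi>_def coord_space_def)
    show "(\<lambda>x. \<Sum>i<card B. s (x i) (b i)) ` coord_space (card B) \<subseteq> span B"
      using span_base[OF bB] by (auto intro!: span_sum span_scale simp del: span_base)
  qed (use expand coords in auto)
  with lin show ?thesis by blast
qed

section \<open>Averaging over Haar measure\<close>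

locale compact_group_representation = fd_representation G X smul V \<rho>
  for G :: "('g, 'm) monoid_scheme" (structure) and X
    and smul :: "'k::real_normed_field \<Rightarrow> 'v::euclidean_space \<Rightarrow> 'v" and V \<rho> +
  fixes \<mu> :: "'g measure"
  assumes compact: "compact_space X"
    and topspace_X: "topspace X = carrier G"
    and continuous_mult: "continuous_map (prod_topology X X) X (\<lambda>(g, h). g \<otimes> h)"
    and continuous_inv: "continuous_map X X (\<lambda>g. inv g)"
    and haar: "normalized_haar_measure G X \<mu>"
    and smul_of_real: "\<And>r v. smul (of_real r) v = r *\<^sub>R v"
begin

text \<open>The link between algebra and analysis: through \<open>smul_of_real\<close>, linearity
  over \<open>'k\<close> contains real linearity, and on a Euclidean space a real linear map is
  bounded.\<close>

lemma linear_imp_bounded_linear: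
  assumes "Vector_Spaces.linear smul smul f"
  shows "bounded_linear f"
proof -
  interpret f: Vector_Spaces.linear smul smul f by fact
  have "Real_Vector_Spaces.linear f"
    using f.add f.scale[of "of_real _"] by (intro linearI) (auto simp: smul_of_real)
  then show ?thesis by (simp add: linear_conv_bounded_linear)
qed

lemma bounded_linear_smul: "bounded_linear (smul c)"
  by (rule linear_imp_bounded_linear, unfold_locales) (auto simp: scale_right_distrib mult.commute)

lemma real_subspace: "subspace W \<Longrightarrow> Real_Vector_Spaces.subspace W"
  by (auto simp: Real_Vector_Spaces.subspace_def subspace_def simp flip: smul_of_real)

lemma space_haar: "space \<mu> = carrier G"
  and sets_haar: "sets \<mu> = sigma_sets (carrier G) {U. openin X U}"
  using haar by (auto simp: normalized_haar_measure_def)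

lemma emeasure_haar: "emeasure \<mu> (space \<mu>) = 1"
  using haar unfolding space_haar normalized_haar_measure_def by blast

lemma finite_measure_haar: "finite_measure \<mu>"
  by (rule finite_measureI) (simp add: emeasure_haar)

lemma measurable_continuous:
  fixes f :: "'g \<Rightarrow> 'b::topological_space"
  assumes "continuous_map X euclidean f"
  shows "f \<in> borel_measurable \<mu>"
proof (rule borel_measurableI)
  fix S :: "'b set" assume "open S"
  then have "openin X {x \<in> topspace X. f x \<in> S}"
    using openin_continuous_map_preimage[OF assms, of S] by simp
  moreover have "f -` S \<inter> space \<mu> = {x \<in> topspace X. f x \<in> S}"
    by (auto simp: space_haar topspace_X)
  ultimately show "f -` S \<inter> space \<mu> \<in> sets \<mu>"
    by (auto simp: sets_haar)
qed

text \<open>Compactness bounds the function, and the measure is finite.\<close>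

lemma integrable_continuous:
  fixes f :: "'g \<Rightarrow> 'b::{banach, second_countable_topology}"
  assumes "continuous_map X euclidean f"
  shows "integrable \<mu> f"
proof -
  have "compact (f ` carrier G)"
    using image_compactin[OF _ assms, of "carrier G"] compact
    by (simp add: compact_space_def topspace_X)
  then obtain B where "\<forall>x\<in>carrier G. norm (f x) \<le> B"
    using compact_imp_bounded bounded_iff by (metis imageI)
  then show ?thesis
    by (intro finite_measure.integrable_const_bound[OF finite_measure_haar, where B = B]
        measurable_continuous assms AE_I2)
      (auto simp: space_haar)
qed

lemma continuous_left_translation:
  assumes "h \<in> carrier G"
  shows "continuous_map X X (\<lambda>g. h \<otimes> g)"
proof -
  have "continuous_map X (prod_topology X X) (\<lambda>g. (h, g))"
    using assms by (simp add: continuous_map_pairedI topspace_X)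
  from continuous_map_compose[OF this continuous_mult] show ?thesis
    by (simp add: comp_def)
qed

text \<open>Invariance of Haar measure speaks of cosets, whereas a push-forward is computed from
  preimages. The preimage of \<open>A\<close> under translation by \<open>h\<close> is the coset
  \<open>inv h <# A\<close>.\<close>

lemma distr_left_translation:
  assumes h: "h \<in> carrier G"
  shows "(\<lambda>g. h \<otimes> g) \<in> measurable \<mu> \<mu>" "distr \<mu> \<mu> (\<lambda>g. h \<otimes> g) = \<mu>"
proof -
  interpret group G by (rule group_G)
  have sub: "{U. openin X U} \<subseteq> Pow (carrier G)"
    using openin_subset topspace_X by auto
  \<comment> \<open>Measurability need only be tested on the open sets, which generate the
    sigma-algebra.\<close>
  have "(\<lambda>g. h \<otimes> g) \<in> measurable \<mu> (sigma (carrier G) {U. openin X U})"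
  proof (rule measurable_sigma_sets[OF _ sub])
    show "sets (sigma (carrier G) {U. openin X U}) = sigma_sets (carrier G) {U. openin X U}"
      using sub by simp
    show "(\<lambda>g. h \<otimes> g) \<in> space \<mu> \<rightarrow> carrier G" using h by (auto simp: space_haar)
    fix U assume "U \<in> {U. openin X U}"
    then have "openin X {g \<in> topspace X. h \<otimes> g \<in> U}"
      using openin_continuous_map_preimage[OF continuous_left_translation[OF h]] by blast
    moreover have "(\<lambda>g. h \<otimes> g) -` U \<inter> space \<mu> = {g \<in> topspace X. h \<otimes> g \<in> U}"
      by (auto simp: space_haar topspace_X)
    ultimately show "(\<lambda>g. h \<otimes> g) -` U \<inter> space \<mu> \<in> sets \<mu>"
      by (auto simp: sets_haar)
  qed
  also have "measurable \<mu> (sigma (carrier G) {U. openin X U}) = measurable \<mu> \<mu>"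
    using sub by (intro measurable_cong_sets) (auto simp: sets_haar)
  finally show meas: "(\<lambda>g. h \<otimes> g) \<in> measurable \<mu> \<mu>" .
  show "distr \<mu> \<mu> (\<lambda>g. h \<otimes> g) = \<mu>"
  proof (rule measure_eqI)
    fix A assume "A \<in> sets (distr \<mu> \<mu> (\<lambda>g. h \<otimes> g))"
    then have A: "A \<in> sets \<mu>" by simp
    then have AG: "A \<subseteq> carrier G" using sets.sets_into_space space_haar by blast
    have "(\<lambda>g. h \<otimes> g) -` A \<inter> space \<mu> = inv h <# A"
    proof (intro Set.set_eqI iffI)
      fix x assume x: "x \<in> (\<lambda>g. h \<otimes> g) -` A \<inter> space \<mu>"
      then have "x = inv h \<otimes> (h \<otimes> x)"
        using h inv_solve_left[of x h "h \<otimes> x"] by (simp add: space_haar)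
      then show "x \<in> inv h <# A" using x by (auto simp: l_coset_def)
    next
      fix x assume "x \<in> inv h <# A"
      then obtain a where a: "a \<in> A" "x = inv h \<otimes> a" by (auto simp: l_coset_def)
      then have "x \<in> carrier G" "h \<otimes> x = a"
        using h AG inv_solve_left[of x h a] by auto
      then show "x \<in> (\<lambda>g. h \<otimes> g) -` A \<inter> space \<mu>"
        using a by (simp add: space_haar)
    qed
    then show "emeasure (distr \<mu> \<mu> (\<lambda>g. h \<otimes> g)) A = emeasure \<mu> A"
      using haar h A by (simp add: emeasure_distr[OF meas A] normalized_haar_measure_def)
  qed simp
qed

lemma integral_left_translation:
  fixes f :: "'g \<Rightarrow> 'v"
  assumes "h \<in> carrier G" "continuous_map X euclidean f"
  shows "(\<integral>g. f (h \<otimes> g) \<partial>\<mu>) = (\<integral>g. f g \<partial>\<mu>)"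
  using integral_distr[OF distr_left_translation(1)[OF assms(1)] measurable_continuous[OF assms(2)]]
  by (simp add: distr_left_translation(2)[OF assms(1)])

lemma integral_constant: "(\<integral>g. v \<partial>\<mu>) = (v::'v)"
  by (simp add: measure_def emeasure_haar)

text \<open>A linear projection onto \<open>U\<close> fixes the integrand and commutes with the
  integral, so the integral lies in its range.\<close>

lemma integral_in_subspace:
  assumes "subspace U" "continuous_map X euclidean f" "\<And>g. g \<in> carrier G \<Longrightarrow> f g \<in> U"
  shows "(\<integral>g. f g \<partial>\<mu>) \<in> U"
proof -
  obtain p where p: "Vector_Spaces.linear smul smul p" "range p \<subseteq> U" "\<forall>u\<in>U. p u = u"
    using exists_projection[OF assms(1)] by blast
  have "(\<integral>g. f g \<partial>\<mu>) = (\<integral>g. p (f g) \<partial>\<mu>)"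
    using assms(3) p(3) by (intro Bochner_Integration.integral_cong) (auto simp: space_haar)
  also have "\<dots> = p (\<integral>g. f g \<partial>\<mu>)"
    by (intro integral_bounded_linear linear_imp_bounded_linear p integrable_continuous assms)
  finally show ?thesis using p(2) by (metis rangeI subsetD)
qed

text \<open>Since \<open>\<rho> h\<close> is linear only on \<open>V\<close>, it is composed with a
  map \<open>q\<close> into \<open>V\<close>; the result is linear on the whole space, hence
  bounded. When \<open>q\<close> fixes \<open>V\<close>, nothing changes for arguments in
  \<open>V\<close>.\<close>

lemma bounded_linear_action_projection:
  assumes "h \<in> carrier G" "Vector_Spaces.linear smul smul q" "range q \<subseteq> V"
  shows "bounded_linear (\<lambda>v. \<rho> h (q v))"
proof (rule linear_imp_bounded_linear)
  interpret q: Vector_Spaces.linear smul smul q by fact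
  have "q v \<in> V" for v using assms(3) by auto
  then show "Vector_Spaces.linear smul smul (\<lambda>v. \<rho> h (q v))"
    using assms(1) by unfold_locales (auto simp: q.add q.scale action_add action_scale)
qed

lemma action_integral:
  assumes "h \<in> carrier G" "continuous_map X euclidean f" "\<And>g. g \<in> carrier G \<Longrightarrow> f g \<in> V"
  shows "\<rho> h (\<integral>g. f g \<partial>\<mu>) = (\<integral>g. \<rho> h (f g) \<partial>\<mu>)"
proof -
  obtain q where q: "Vector_Spaces.linear smul smul q" "range q \<subseteq> V" "\<forall>v\<in>V. q v = v"
    using exists_projection[OF subspace_V] by blast
  have "\<rho> h (\<integral>g. f g \<partial>\<mu>) = \<rho> h (q (\<integral>g. f g \<partial>\<mu>))"
    using integral_in_subspace[OF subspace_V assms(2,3)] q(3) by simp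
  also have "\<dots> = (\<integral>g. \<rho> h (q (f g)) \<partial>\<mu>)"
    by (intro integral_bounded_linear[symmetric] bounded_linear_action_projection
        integrable_continuous assms q)
  also have "\<dots> = (\<integral>g. \<rho> h (f g) \<partial>\<mu>)"
    using assms(3) q(3) by (intro Bochner_Integration.integral_cong) (auto simp: space_haar)
  finally show ?thesis .
qed

text \<open>Orbit maps are continuous for each fixed vector, but here the vector moves with
  \<open>g\<close>. Finite dimension bridges the gap: in coordinates the map is a finite sum of
  continuous coefficients times orbit maps.\<close>

lemma continuous_action:
  assumes "continuous_map X euclidean w" "\<And>g. g \<in> carrier G \<Longrightarrow> w g \<in> V"
  shows "continuous_map X euclidean (\<lambda>g. \<rho> g (w g))"
proof -
  obtain q where q: "Vector_Spaces.linear smul smul q" "range q \<subseteq> V" "\<forall>v\<in>V. q v = v"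
    using exists_projection[OF subspace_V] by blast
  \<comment> \<open>A Euclidean basis vector \<open>b\<close> need not lie in \<open>V\<close>;
    \<open>q b\<close> does, so its orbit map is continuous.\<close>
  have "continuous_map X euclidean (\<lambda>g. \<Sum>b\<in>Basis. (w g \<bullet> b) *\<^sub>R \<rho> g (q b))"
  proof (intro continuous_map_sum)
    fix b :: 'v assume "b \<in> Basis"
    have "continuous_map X euclidean (\<lambda>g. \<rho> g (q b))"
      using q(2) by (intro continuous_orbit) auto
    then show "continuous_map X euclidean (\<lambda>g. (w g \<bullet> b) *\<^sub>R \<rho> g (q b))"
      using assms(1) unfolding continuous_map_atin limitin_canonical_iff
      by (auto intro!: tendsto_scaleR tendsto_inner tendsto_const)
  qed simp
  moreover have "\<rho> g (w g) = (\<Sum>b\<in>Basis. (w g \<bullet> b) *\<^sub>R \<rho> g (q b))" if g: "g \<in> topspace X" for g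
  proof -
    interpret L: bounded_linear "\<lambda>v. \<rho> g (q v)"
      using bounded_linear_action_projection[OF _ q(1,2)] g topspace_X by simp
    have "\<rho> g (w g) = \<rho> g (q (\<Sum>b\<in>Basis. (w g \<bullet> b) *\<^sub>R b))"
      using g assms(2) q(3) by (simp add: euclidean_representation topspace_X)
    also have "\<dots> = (\<Sum>b\<in>Basis. (w g \<bullet> b) *\<^sub>R \<rho> g (q b))"
      by (simp only: L.sum L.scaleR)
    finally show ?thesis .
  qed
  ultimately show ?thesis by (rule continuous_map_eq[OF _ sym])
qed

lemma continuous_bounded_linear:
  assumes "bounded_linear p" "continuous_map X euclidean f"
  shows "continuous_map X euclidean (\<lambda>g. p (f g))"
  using assms(2) unfolding continuous_map_atin limitin_canonical_iff
  by (blast intro: bounded_linear.tendsto[OF assms(1)])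

text \<open>Averaging replaces the invariant inner product of the usual unitary trick: it needs no
  conjugation on the ground field.\<close>

lemma exists_equivariant_projection:
  assumes "invariant_subspace G smul V \<rho> W"
  obtains P where "linear_map_on smul V smul W P"
    "\<And>g v. g \<in> carrier G \<Longrightarrow> v \<in> V \<Longrightarrow> P (\<rho> g v) = \<rho> g (P v)"
    "\<And>w. w \<in> W \<Longrightarrow> P w = w"
proof -
  interpret group G by (rule group_G)
  have W: "subspace W" "W \<subseteq> V" and closed: "\<And>g w. g \<in> carrier G \<Longrightarrow> w \<in> W \<Longrightarrow> \<rho> g w \<in> W"
    using assms by (auto simp: invariant_subspace_def)
  obtain p where p: "Vector_Spaces.linear smul smul p" "range p \<subseteq> W" "\<forall>w\<in>W. p w = w"
    using exists_projection[OF W(1)] by blast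
  interpret p: Vector_Spaces.linear smul smul p by fact
  have pW: "p v \<in> W" for v using p(2) by auto
  then have pV: "p v \<in> V" for v using W(2) by auto
  define F where "F v g = \<rho> g (p (\<rho> (inv g) v))" for v g
  define P where "P v = (\<integral>g. F v g \<partial>\<mu>)" for v
  have FW: "F v g \<in> W" if "g \<in> carrier G" for v g
    using that closed pW by (simp add: F_def)
  have F_cont: "continuous_map X euclidean (F v)" if "v \<in> V" for v
  proof -
    have "continuous_map X euclidean (\<lambda>g. \<rho> (inv g) v)"
      using continuous_map_compose[OF continuous_inv continuous_orbit[OF that]] by (simp add: o_def)
    then show ?thesis
      unfolding F_def
      by (rule continuous_action[OF
            continuous_bounded_linear[OF linear_imp_bounded_linear[OF p(1)]] pV])
  qed
  note F_int = integrable_continuous[OF F_cont]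
  have "P (u + v) = P u + P v" if "u \<in> V" "v \<in> V" for u v
  proof -
    have "P (u + v) = (\<integral>g. F u g + F v g \<partial>\<mu>)"
      unfolding P_def using that
      by (intro Bochner_Integration.integral_cong) (auto simp: F_def space_haar action_add p.add pV)
    then show ?thesis using F_int that by (simp add: P_def)
  qed
  moreover have "P (smul c v) = smul c (P v)" if "v \<in> V" for c v
  proof -
    have "P (smul c v) = (\<integral>g. smul c (F v g) \<partial>\<mu>)"
      unfolding P_def using that
      by (intro Bochner_Integration.integral_cong) (auto simp: F_def space_haar action_scale p.scale pV)
    then show ?thesis
      unfolding P_def using integral_bounded_linear[OF bounded_linear_smul F_int[OF that]] by simp
  qed
  moreover have "P v \<in> W" if "v \<in> V" for v
    unfolding P_def by (intro integral_in_subspace W F_cont FW that)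
  ultimately have "linear_map_on smul V smul W P" by (simp add: linear_map_on_def)
  moreover have "P (\<rho> h v) = \<rho> h (P v)" if h: "h \<in> carrier G" and v: "v \<in> V" for h v
  proof -
    have "\<rho> h (P v) = (\<integral>g. \<rho> h (F v g) \<partial>\<mu>)"
      unfolding P_def using F_cont FW W(2) h v by (intro action_integral) auto
    \<comment> \<open>The substitution behind equivariance:
      \<open>\<rho> (inv (h \<otimes> g))\<close> applied to \<open>\<rho> h v\<close> cancels
      \<open>h\<close> and leaves \<open>\<rho> (inv g) v\<close>.\<close>
    also have "\<dots> = (\<integral>g. F (\<rho> h v) (h \<otimes> g) \<partial>\<mu>)"
      using h v pV
      by (intro Bochner_Integration.integral_cong)
        (auto simp: F_def space_haar inv_mult_group action_closed composition_rule
          orbit_sym_aux)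
    also have "\<dots> = P (\<rho> h v)"
      unfolding P_def by (intro integral_left_translation F_cont action_closed h v)
    finally show ?thesis by simp
  qed
  moreover have "P w = w" if w: "w \<in> W" for w
  proof -
    \<comment> \<open>Every conjugate of \<open>p\<close> fixes \<open>W\<close> pointwise, since
      \<open>\<rho> (inv g) w\<close> is again in \<open>W\<close>. The integrand is constant, and
      total mass 1 gives \<open>P w = w\<close>.\<close>
    have "F w g = w" if g: "g \<in> carrier G" for g
    proof -
      have "p (\<rho> (inv g) w) = \<rho> (inv g) w" using p(3) closed g w by simp
      then show ?thesis
        using g w W(2) composition_rule[of w g "inv g"] action_one[of w] by (auto simp: F_def)
    qed
    then have "P w = (\<integral>g. w \<partial>\<mu>)"
      unfolding P_def by (intro Bochner_Integration.integral_cong) (auto simp: space_haar)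
    then show ?thesis by (simp only: integral_constant)
  qed
  ultimately show ?thesis using that by blast
qed


text \<open>A nonzero invariant subspace of least dimension is irreducible. Real dimension serves as
  well as dimension over \<open>'k\<close>, because all that counts is its strict growth under
  proper inclusion of subspaces.\<close>

lemma exists_irreducible_subspace:
  assumes "invariant_subspace G smul V \<rho> U" "U \<noteq> {0}"
  obtains W where "irreducible_subspace G X smul V \<rho> W" "W \<subseteq> U"
proof -
  define P where "P W \<longleftrightarrow> invariant_subspace G smul V \<rho> W \<and> W \<noteq> {0} \<and> W \<subseteq> U" for W
  have "P U" using assms by (simp add: P_def)
  then obtain W where W: "P W" and min: "\<And>W'. P W' \<Longrightarrow> Real_Vector_Spaces.dim W \<le> Real_Vector_Spaces.dim W'"
    using ex_has_least_nat[of P U "\<lambda>W. Real_Vector_Spaces.dim W"] by blast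
  have "W' = W" if "invariant_subspace G smul V \<rho> W'" "W' \<subseteq> W" "W' \<noteq> {0}" for W'
  proof -
    have "P W'" using that W by (auto simp: P_def)
    then show ?thesis
      using that W min
      by (intro subspace_dim_equal real_subspace) (auto simp: P_def invariant_subspace_def)
  qed
  then have "irreducible_subspace G X smul V \<rho> W"
    unfolding irreducible_subspace_iff using W P_def by blast
  then show ?thesis using that W by (auto simp: P_def)
qed

end

section \<open>Schur's lemma and complete reducibility\<close>

lemma invariant_subspaceD:
  assumes "invariant_subspace G smul V \<rho> W"
  shows "module.subspace smul W" "W \<subseteq> V" "\<And>g w. g \<in> carrier G \<Longrightarrow> w \<in> W \<Longrightarrow> \<rho> g w \<in> W"
  using assms by (auto simp: invariant_subspace_def image_subset_iff)

context fd_representation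
begin

text \<open>The vector \<open>w\<close> shows that the kernel of \<open>P\<close> in
  \<open>W1\<close> is proper and that the image of \<open>W1\<close> is not zero; minimality of
  \<open>W1\<close> and \<open>W2\<close> then makes \<open>P\<close> bijective. The map is given on
  all of \<open>V\<close> because it will be an equivariant projection onto
  \<open>W2\<close>.\<close>

lemma schur:
  assumes W1: "irreducible_subspace G X smul V \<rho> W1"
    and W2: "irreducible_subspace G X smul V \<rho> W2"
    and lin: "linear_map_on smul V smul W2 P"
    and equivariant: "\<And>g v. g \<in> carrier G \<Longrightarrow> v \<in> V \<Longrightarrow> P (\<rho> g v) = \<rho> g (P v)"
    and nonzero: "w \<in> W1" "P w \<noteq> 0"
  shows "equivalent_representations G
    smul W1 (\<lambda>g. restrict (\<rho> g) W1) smul W2 (\<lambda>g. restrict (\<rho> g) W2)"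
proof -
  note S1 = invariant_subspaceD[OF conjunct1[OF W1]] and S2 = invariant_subspaceD[OF conjunct1[OF W2]]
  have P: "\<And>u v. u \<in> V \<Longrightarrow> v \<in> V \<Longrightarrow> P (u + v) = P u + P v"
    "\<And>c v. v \<in> V \<Longrightarrow> P (smul c v) = smul c (P v)" "\<And>v. v \<in> V \<Longrightarrow> P v \<in> W2"
    using lin by (auto simp: linear_map_on_def)
  have P0: "P 0 = 0"
    by (rule linear_map_on_zero[OF vector_space_axioms subspace_V vector_space_axioms lin])
  let ?K = "{w \<in> W1. P w = 0}"
  have "subspace ?K"
    using S1 P P0 by (auto intro!: subspaceI simp: subspace_0 subspace_add subspace_scale subset_iff)
  then have "invariant_subspace G smul V \<rho> ?K"
    using S1 equivariant action_zero by (auto simp: invariant_subspace_def subset_iff)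
  then have K: "?K = {0}"
    using W1 nonzero unfolding irreducible_subspace_iff by blast
  have inj: "inj_on P W1"
  proof (rule inj_onI)
    fix x y assume xy: "x \<in> W1" "y \<in> W1" "P x = P y"
    then have "x - y \<in> W1" using S1(1) subspace_diff by blast
    moreover have "P x = P (x - y) + P y" using P(1)[of "x - y" y] calculation xy S1(2) by auto
    ultimately have "x - y \<in> ?K" using xy by simp
    then show "x = y" using K by simp
  qed
  have "subspace (P ` W1)"
    by (rule linear_map_on_image_subspace[OF vector_space_axioms subspace_V vector_space_axioms lin S1(1,2)])
  moreover have "\<rho> g (P w) \<in> P ` W1" if "g \<in> carrier G" "w \<in> W1" for g w
    using that S1 equivariant[of g w] by (metis imageI subsetD)
  ultimately have "invariant_subspace G smul V \<rho> (P ` W1)"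
    using S1(2) S2(2) P(3) by (auto simp: invariant_subspace_def subset_iff)
  moreover have "P ` W1 \<subseteq> W2" using S1(2) P(3) by auto
  moreover have "P ` W1 \<noteq> {0}" using nonzero by auto
  ultimately have "P ` W1 = W2"
    using W2 unfolding irreducible_subspace_iff by blast
  then have "bij_betw P W1 W2" using inj by (simp add: bij_betw_def)
  moreover have "linear_map_on smul W1 smul W2 P"
    using lin S1(2) by (auto simp: linear_map_on_def subset_iff)
  ultimately show ?thesis
    unfolding equivalent_representations_def
    using S1 S2 P(3) equivariant by (intro exI[of _ P]) (auto simp: subset_iff)
qed

lemma invariant_subspace_span_Union:
  assumes "\<And>W. W \<in> \<W> \<Longrightarrow> invariant_subspace G smul V \<rho> W"
  shows "invariant_subspace G smul V \<rho> (span (\<Union>\<W>))"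
proof -
  have sub: "span (\<Union>\<W>) \<subseteq> V"
    using assms by (intro span_minimal subspace_V) (auto simp: invariant_subspace_def)
  have "\<rho> g v \<in> span (\<Union>\<W>)" if g: "g \<in> carrier G" and "v \<in> span (\<Union>\<W>)" for g v
  proof -
    \<comment> \<open>As the action is additive only on \<open>V\<close>, the induction has to keep
      track of membership in \<open>V\<close>.\<close>
    have "v \<in> V \<and> \<rho> g v \<in> span (\<Union>\<W>)"
      using that(2)
    proof (induction rule: span_induct_alt)
      case base
      show ?case using action_zero[OF g] by (simp add: span_zero subspace_0[OF subspace_V])
    next
      case (step c x y)
      then obtain W where W: "W \<in> \<W>" "x \<in> W" by blast
      then have "x \<in> V" "\<rho> g x \<in> W" using assms[OF W(1)] g by (auto simp: invariant_subspace_def)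
      then have "y \<in> V" "\<rho> g y \<in> span (\<Union>\<W>)" "\<rho> g x \<in> span (\<Union>\<W>)"
        using step.IH W(1) by (auto intro!: span_base)
      then show ?case
        using \<open>x \<in> V\<close> g
        by (simp add: action_add action_scale subspace_add subspace_scale subspace_V
            span_add span_scale)
    qed
    then show ?thesis by blast
  qed
  then show ?thesis using sub by (auto simp: invariant_subspace_def)
qed

lemma invariant_subspace_Int:
  assumes "invariant_subspace G smul V \<rho> U" "invariant_subspace G smul V \<rho> W"
  shows "invariant_subspace G smul V \<rho> (U \<inter> W)"
  using invariant_subspaceD[OF assms(1)] invariant_subspaceD[OF assms(2)] subspace_inter[of U W]
  by (auto simp: invariant_subspace_def)

lemma invariant_subspace_invariant_vectors:
  "invariant_subspace G smul V \<rho> (invariant_vectors G V \<rho>)"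
proof -
  have "subspace (invariant_vectors G V \<rho>)"
    using subspace_V
    by (auto intro!: subspaceI simp: invariant_vectors_def subspace_0 subspace_add subspace_scale
        action_zero action_add action_scale)
  then show ?thesis by (auto simp: invariant_subspace_def invariant_vectors_def)
qed

lemma invariant_subspace_isotypic_component:
  "invariant_subspace G smul V \<rho> (isotypic_component G X smul V \<rho> c)"
  unfolding isotypic_component_def by (rule invariant_subspace_span_Union) blast

end

context compact_group_representation
begin

text \<open>The sum of all irreducible subspaces is compared with \<open>V\<close> in one stroke,
  without induction on the dimension. If it were smaller, the kernel of an equivariant projection
  onto it would contain an irreducible subspace; this lies in the sum as well, so the projection
  would be both zero and the identity on it.\<close>

lemma span_irreducible_subspaces:
  "span (\<Union>{W. irreducible_subspace G X smul V \<rho> W}) = V"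
proof (rule ccontr)
  let ?S = "span (\<Union>{W. irreducible_subspace G X smul V \<rho> W})"
  assume ne: "?S \<noteq> V"
  have S: "invariant_subspace G smul V \<rho> ?S"
    by (rule invariant_subspace_span_Union) blast
  obtain P where P: "linear_map_on smul V smul ?S P"
    "\<And>g v. g \<in> carrier G \<Longrightarrow> v \<in> V \<Longrightarrow> P (\<rho> g v) = \<rho> g (P v)"
    "\<And>w. w \<in> ?S \<Longrightarrow> P w = w"
    using exists_equivariant_projection[OF S] by blast
  have SV: "?S \<subseteq> V" using S by (simp add: invariant_subspace_def)
  have P0: "P 0 = 0"
    by (rule linear_map_on_zero[OF vector_space_axioms subspace_V vector_space_axioms P(1)])
  let ?K = "{v \<in> V. P v = 0}"
  have "subspace ?K"
    using P(1) P0 subspace_V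
    by (auto intro!: subspaceI simp: linear_map_on_def subspace_0 subspace_add subspace_scale)
  then have K: "invariant_subspace G smul V \<rho> ?K"
    using P(2) action_zero action_closed by (auto simp: invariant_subspace_def)
  obtain v where v: "v \<in> V" "v \<notin> ?S" using ne SV by blast
  have Pv: "P v \<in> ?S" using P(1) v by (auto simp: linear_map_on_def)
  have P_add: "\<And>x y. x \<in> V \<Longrightarrow> y \<in> V \<Longrightarrow> P (x + y) = P x + P y"
    using P(1) by (simp add: linear_map_on_def)
  have d: "v - P v \<in> V" using v Pv SV subspace_V subspace_diff by blast
  have "P v = P (v - P v) + P (P v)"
    using P_add[OF d subsetD[OF SV Pv]] by simp
  then have "v - P v \<in> ?K" using d P(3)[OF Pv] by simp
  moreover have "v - P v \<noteq> 0" using v Pv by auto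
  ultimately have "?K \<noteq> {0}" by blast
  from exists_irreducible_subspace[OF K this] obtain W
    where W: "irreducible_subspace G X smul V \<rho> W" "W \<subseteq> ?K" .
  have WS: "W \<subseteq> ?S" using W(1) by (intro order_trans[OF _ span_superset] Union_upper) simp
  have "W \<subseteq> {0}"
  proof
    fix w assume w: "w \<in> W"
    then have "P w = w" "P w = 0" using P(3)[OF subsetD[OF WS w]] subsetD[OF W(2) w] by simp_all
    then show "w \<in> {0}" by simp
  qed
  moreover have "W \<noteq> {0}" using W(1) unfolding irreducible_subspace_iff by blast
  moreover have "0 \<in> W" using subspace_0[OF invariant_subspaceD(1)[OF conjunct1[OF W(1)]]] .
  ultimately show False by blast
qed

end

section \<open>Isotypic components\<close>

text \<open>The index set may be infinite, so a decomposition is a finitely supported family. For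
  existence, adding a multiple of a vector of \<open>F j\<close> alters only the entry at
  \<open>j\<close>. For uniqueness, the difference of two families at \<open>i\<close> equals a sum
  of differences at other indices, so it lies both in \<open>F i\<close> and in the span of the
  others.\<close>

lemma (in vector_space) is_direct_sumI:
  assumes sub: "\<And>i. i \<in> I \<Longrightarrow> subspace (F i)" "\<And>i. i \<in> I \<Longrightarrow> F i \<subseteq> V"
    and gen: "V \<subseteq> span (\<Union>i\<in>I. F i)"
    and indep: "\<And>i. i \<in> I \<Longrightarrow> F i \<inter> span (\<Union>j\<in>I - {i}. F j) \<subseteq> {0}"
  shows "is_direct_sum scale V I F"
proof -
  define good where "good v f \<longleftrightarrow> (\<forall>i\<in>I. f i \<in> F i) \<and> (\<forall>i. i \<notin> I \<longrightarrow> f i = 0) \<and>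
    finite {i. f i \<noteq> 0} \<and> v = (\<Sum>i | f i \<noteq> 0. f i)" for v f
  have sum_eq: "(\<Sum>i\<in>S. f i) = v" if "good v f" "finite S" "{i. f i \<noteq> 0} \<subseteq> S" for v f S
  proof -
    have "(\<Sum>i | f i \<noteq> 0. f i) = (\<Sum>i\<in>S. f i)"
      using that(2,3) by (intro sum.mono_neutral_left) auto
    then show ?thesis using that(1) by (simp add: good_def)
  qed
  have ex: "\<exists>f. good v f" if "v \<in> span (\<Union>i\<in>I. F i)" for v
    using that
  proof (induction rule: span_induct_alt)
    case base
    have "good 0 (\<lambda>_. 0)" using sub subspace_0 by (auto simp: good_def)
    then show ?case by blast
  next
    case (step c x y)
    then obtain j f where j: "j \<in> I" "x \<in> F j" and f: "good y f" by blast
    define f' where "f' = f(j := scale c x + f j)"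
    let ?S = "insert j {i. f i \<noteq> 0}"
    have fin: "finite ?S" and sup: "{i. f' i \<noteq> 0} \<subseteq> ?S" using f by (auto simp: good_def f'_def)
    have "(\<Sum>i | f' i \<noteq> 0. f' i) = (\<Sum>i\<in>?S. f' i)"
      using fin sup by (intro sum.mono_neutral_left) auto
    also have "\<dots> = f' j + (\<Sum>i\<in>?S - {j}. f' i)" by (rule sum.remove[OF fin]) simp
    also have "(\<Sum>i\<in>?S - {j}. f' i) = (\<Sum>i\<in>?S - {j}. f i)" by (intro sum.cong) (auto simp: f'_def)
    also have "f' j + \<dots> = scale c x + (\<Sum>i\<in>?S. f i)"
      using sum.remove[OF fin, of j f] by (simp add: f'_def add.assoc)
    also have "\<dots> = scale c x + y" using sum_eq[OF f fin] by auto
    finally have "scale c x + y = (\<Sum>i | f' i \<noteq> 0. f' i)" by simp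
    moreover have "f' i \<in> F i" if "i \<in> I" for i
      using that j f sub(1) by (auto simp: f'_def good_def subspace_add subspace_scale)
    moreover have "f' i = 0" if "i \<notin> I" for i using that j f by (auto simp: f'_def good_def)
    ultimately have "good (scale c x + y) f'"
      using finite_subset[OF sup fin] by (simp add: good_def)
    then show ?case by blast
  qed
  have uniq: "f = f'" if f: "good v f" and f': "good v f'" for v f f'
  proof
    fix i
    show "f i = f' i"
    proof (cases "i \<in> I")
      case True
      \<comment> \<open>A common finite support of both families, enlarged by \<open>i\<close> so
        that this entry can be split off.\<close>
      let ?S = "insert i ({i. f i \<noteq> 0} \<union> {i. f' i \<noteq> 0})"
      have fin: "finite ?S" using f f' by (auto simp: good_def)
      have "f i + (\<Sum>j\<in>?S - {i}. f j) = f' i + (\<Sum>j\<in>?S - {i}. f' j)"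
      proof -
        have "(\<Sum>j\<in>?S. f j) = v" "(\<Sum>j\<in>?S. f' j) = v"
          by (rule sum_eq[OF f fin], blast) (rule sum_eq[OF f' fin], blast)
        then show ?thesis by (simp only: sum.remove[OF fin insertI1, symmetric])
      qed
      then have "f i - f' i = (\<Sum>j\<in>?S - {i}. f' j - f j)"
        unfolding sum_subtractf by (simp add: algebra_simps)
      also have "\<dots> \<in> span (\<Union>j\<in>I - {i}. F j)"
      proof (rule span_sum)
        fix j assume "j \<in> ?S - {i}"
        then have "j \<in> I - {i}" using f f' by (auto simp: good_def)
        moreover from this have "f' j - f j \<in> F j"
          using f f' sub(1) by (auto simp: good_def subspace_diff)
        ultimately show "f' j - f j \<in> span (\<Union>j\<in>I - {i}. F j)" by (intro span_base) blast
      qed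
      finally have "f i - f' i \<in> F i \<inter> span (\<Union>j\<in>I - {i}. F j)"
        using True f f' sub(1) by (auto simp: good_def subspace_diff)
      then show ?thesis using indep[OF True] by auto
    next
      case False
      then show ?thesis using f f' by (simp add: good_def)
    qed
  qed
  have ex1: "\<exists>!f. good v f" if "v \<in> V" for v
  proof -
    from ex[OF subsetD[OF gen that]] obtain f where "good v f" ..
    then show ?thesis using uniq by auto
  qed
  show ?thesis
    unfolding is_direct_sum_def by (intro conjI ballI sub ex1[unfolded good_def])
qed

section \<open>Classes of irreducible representations\<close>

lemma equiv_irrep_equiv:
  "equiv (irreps G X :: ('g, 'k::real_normed_field) coord_rep set) (irrep_equiv G X)"
proof (rule equivI)
  show "irrep_equiv G X \<subseteq> irreps G X \<times> (irreps G X :: ('g, 'k) coord_rep set)"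
    by (auto simp: irrep_equiv_def)
  show "refl_on (irreps G X :: ('g, 'k) coord_rep set) (irrep_equiv G X)"
    by (auto simp: refl_on_def irrep_equiv_def equivalent_representations_refl)
  have "fd_representation G X coord_smul U \<tau>"
    if "(U, \<tau>) \<in> irreps G X" for U :: "(nat \<Rightarrow> 'k) set" and \<tau> :: "'g \<Rightarrow> _"
    using that by (auto simp: irreps_def irreducible_representation_def)
  then show "sym (irrep_equiv G X :: ('g, 'k) coord_rep rel)"
    unfolding sym_def irrep_equiv_def using equivalent_representations_sym by blast
  show "trans (irrep_equiv G X :: ('g, 'k) coord_rep rel)"
    unfolding trans_def irrep_equiv_def using equivalent_representations_trans by blast
qed

text \<open>A class consists of representations on coordinate spaces, so a representation on any
  other space belongs to it only up to equivalence.\<close>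

definition class_contains ::
  "('g, 'm) monoid_scheme \<Rightarrow> ('k::real_normed_field \<Rightarrow> 'v \<Rightarrow> 'v::{ab_group_add, topological_space}) \<Rightarrow>
   'v set \<Rightarrow> ('g \<Rightarrow> 'v \<Rightarrow> 'v) \<Rightarrow> ('g, 'k) coord_rep set \<Rightarrow> bool" where
  "class_contains G smul W \<sigma> c \<longleftrightarrow>
     (\<exists>(U, \<tau>)\<in>c. equivalent_representations G smul W \<sigma> coord_smul U \<tau>)"

lemma isotypic_component_eq:
  "isotypic_component G X smul V \<rho> c =
     module.span smul (\<Union>{W. irreducible_subspace G X smul V \<rho> W \<and>
       class_contains G smul W (\<lambda>g. restrict (\<rho> g) W) c})"
  by (simp add: isotypic_component_def class_contains_def conj_assoc)

text \<open>The equivalence of \<open>W\<close> and \<open>W'\<close> links a representative of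
  \<open>c\<close> to one of \<open>c'\<close>, and related representatives have the same class. It
  serves for two different subspaces of \<open>V\<close> and also, with the identity map, for one
  subspace and two classes.\<close>

lemma dual_object_class_unique:
  assumes c: "c \<in> dual_object G X" "class_contains G s W \<sigma> c"
    and c': "c' \<in> dual_object G X" "class_contains G s' W' \<sigma>' c'"
    and fd: "fd_representation G X s W \<sigma>"
    and eq: "equivalent_representations G s W \<sigma> s' W' \<sigma>'"
  shows "c = c'"
proof -
  obtain U \<tau> where U: "(U, \<tau>) \<in> c" "equivalent_representations G s W \<sigma> coord_smul U \<tau>"
    using c(2) by (auto simp: class_contains_def)
  obtain U' \<tau>' where U': "(U', \<tau>') \<in> c'" "equivalent_representations G s' W' \<sigma>' coord_smul U' \<tau>'"
    using c'(2) by (auto simp: class_contains_def)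
  have "equivalent_representations G coord_smul U \<tau> coord_smul U' \<tau>'"
    by (rule equivalent_representations_trans[OF equivalent_representations_trans[OF
          equivalent_representations_sym[OF fd U(2)] eq] U'(2)])
  moreover have "(U, \<tau>) \<in> irreps G X" "(U', \<tau>') \<in> irreps G X"
    by (rule subsetD[OF in_quotient_imp_subset[OF equiv_irrep_equiv c(1)[unfolded dual_object_def]] U(1)])
      (rule subsetD[OF in_quotient_imp_subset[OF equiv_irrep_equiv c'(1)[unfolded dual_object_def]] U'(1)])
  ultimately have "((U, \<tau>), (U', \<tau>')) \<in> irrep_equiv G X" by (simp add: irrep_equiv_def)
  then show ?thesis
    by (rule quotient_eqI[OF equiv_irrep_equiv c(1)[unfolded dual_object_def]
          c'(1)[unfolded dual_object_def] U(1) U'(1)])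
qed

text \<open>Vectors of \<open>coord_space 1\<close> are determined by their entry at 0, so any
  nonzero one generates the space and no proper nonzero subspace exists.\<close>

lemma trivial_irrep:
  assumes "group G" "topspace X = carrier G"
  shows "(coord_space 1, \<lambda>g. \<lambda>x\<in>coord_space 1. x) \<in> (irreps G X :: ('g, 'k::real_normed_field) coord_rep set)"
proof -
  interpret group G by fact
  interpret C: vector_space "coord_smul :: 'k \<Rightarrow> _" by (rule vector_space_coord_smul)
  let ?U = "coord_space 1 :: (nat \<Rightarrow> 'k) set"
  have line: "x = coord_smul (x 0 / y 0) y" if "x \<in> ?U" "y \<in> ?U" "y 0 \<noteq> 0" for x y
  proof
    fix i show "x i = coord_smul (x 0 / y 0) y i"
      using that by (cases "i = 0") (auto simp: coord_space_def coord_smul_def)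
  qed
  have sub: "C.subspace ?U"
    by (rule C.subspaceI) (auto simp: coord_space_def coord_smul_def)
  define e :: "nat \<Rightarrow> 'k" where "e = (\<lambda>i. if i = 0 then 1 else 0)"
  have e: "e \<in> ?U" "e 0 \<noteq> 0" by (auto simp: e_def coord_space_def)
  have "?U = C.span {e}"
    using line[OF _ e] sub e(1) C.span_minimal[of "{e}" ?U] C.span_base[of e "{e}"] C.span_scale
    by (metis (no_types, lifting) empty_subsetI insert_subset singletonI subsetI subset_antisym)
  then have fin: "\<exists>B. finite B \<and> ?U = C.span B" by blast
  have "fd_representation G X coord_smul ?U (\<lambda>g. \<lambda>x\<in>?U. x)"
  proof (intro fd_representation.intro fd_representation_axioms.intro)
    show "vector_space (coord_smul :: 'k \<Rightarrow> _)" by (rule vector_space_coord_smul)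
    show "group_action G ?U (\<lambda>g. \<lambda>x\<in>?U. x)"
      by (intro group_actionI assms(1)) auto
    show "linear_map_on coord_smul ?U coord_smul ?U (\<lambda>x\<in>?U. x)" for g
      using sub by (auto simp: linear_map_on_def C.subspace_add C.subspace_scale)
    show "\<exists>B. finite B \<and> ?U = C.span B" by (rule fin)
    show "continuous_map X euclidean (\<lambda>g. (\<lambda>x\<in>?U. x) v)" for v by simp
  qed
  moreover have "?U \<noteq> {0}"
  proof
    assume "?U = {0}"
    then have "e = 0" using e(1) by simp
    then show False using e(2) by simp
  qed
  moreover have "W = {0} \<or> W = ?U"
    if W: "invariant_subspace G coord_smul ?U (\<lambda>g. \<lambda>x\<in>?U. x) W" for W
  proof (cases "W \<subseteq> {0}")
    case True
    then show ?thesis using C.subspace_0 invariant_subspaceD(1)[OF W] by blast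
  next
    case False
    then obtain y where y: "y \<in> W" "y \<noteq> 0" by blast
    then have yU: "y \<in> ?U" using invariant_subspaceD(2)[OF W] by blast
    have "y 0 \<noteq> 0"
    proof
      assume "y 0 = 0"
      then have "y i = 0" for i using yU by (cases "i = 0") (auto simp: coord_space_def)
      then show False using y(2) by (auto simp: fun_eq_iff)
    qed
    then have "x \<in> W" if "x \<in> ?U" for x
      using line[OF that yU] C.subspace_scale[OF invariant_subspaceD(1)[OF W] y(1)] by metis
    then show ?thesis using invariant_subspaceD(2)[OF W] by blast
  qed
  ultimately show ?thesis by (auto simp: irreps_def irreducible_representation_def)
qed

context compact_group_representation
begin

abbreviation restricted :: "'v set \<Rightarrow> 'g \<Rightarrow> 'v \<Rightarrow> 'v" where
  "restricted W \<equiv> \<lambda>g. restrict (\<rho> g) W"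

text \<open>Continuity into \<open>nat \<Rightarrow> 'k\<close> with the product topology is
  continuity of every coordinate, and one coordinate is a real linear map on a Euclidean
  space.\<close>

lemma bounded_linear_coordinate:
  assumes "Vector_Spaces.linear smul coord_smul \<phi>"
  shows "bounded_linear (\<lambda>v. \<phi> v i)"
proof -
  interpret \<phi>: Vector_Spaces.linear smul coord_smul \<phi> by fact
  have "Real_Vector_Spaces.linear (\<lambda>v. \<phi> v i)"
  proof (rule linearI)
    show "\<phi> (u + v) i = \<phi> u i + \<phi> v i" for u v by (simp add: \<phi>.add)
    show "\<phi> (r *\<^sub>R v) i = r *\<^sub>R \<phi> v i" for r v
      using \<phi>.scale[of "of_real r" v] by (simp add: smul_of_real coord_smul_def scaleR_conv_of_real)
  qed
  then show ?thesis by (simp add: linear_conv_bounded_linear)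
qed

text \<open>A choice of basis \<open>B\<close> copies \<open>W\<close> onto
  \<open>coord_space (card B)\<close>. The copy is irreducible because it is equivalent to
  \<open>W\<close>, and its class is the one sought.\<close>

lemma exists_class:
  assumes W: "irreducible_subspace G X smul V \<rho> W"
  obtains c where "c \<in> dual_object G X" "class_contains G smul W (restricted W) c"
proof -
  note S = invariant_subspaceD[OF conjunct1[OF W]]
  interpret R: fd_representation G X smul W "restricted W"
    by (rule subrepresentation[OF conjunct1[OF W]])
  obtain B where B: "finite B" "independent B" "W = span B"
    using finite_basis_exists[OF S(1,2)] by blast
  obtain \<phi> where \<phi>: "Vector_Spaces.linear smul coord_smul \<phi>"
    and bij: "bij_betw \<phi> W (coord_space (card B))"
    using exists_coordinates[OF vector_space_axioms B(1,2)] B(3) by blast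
  interpret \<phi>: Vector_Spaces.linear smul coord_smul \<phi> by fact
  let ?U = "coord_space (card B) :: (nat \<Rightarrow> 'k) set"
  let ?\<tau> = "\<lambda>g. \<lambda>u\<in>?U. \<phi> (restricted W g (inv_into W \<phi> u))"
  have lin: "linear_map_on smul W coord_smul ?U \<phi>"
    using bij by (auto simp: linear_map_on_def \<phi>.add \<phi>.scale bij_betw_def)
  have cont: "continuous_map X euclidean (\<lambda>g. \<phi> (restricted W g (inv_into W \<phi> u)))" if "u \<in> ?U" for u
  proof -
    have "inv_into W \<phi> u \<in> W" using that bij by (metis bij_betw_def inv_into_into)
    then have "continuous_map X euclidean (\<lambda>g. \<phi> (restricted W g (inv_into W \<phi> u)) i)" for i
      by (intro continuous_bounded_linear[OF bounded_linear_coordinate[OF \<phi>]] R.continuous_orbit)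
    then show ?thesis
      unfolding euclidean_product_topology[symmetric] continuous_map_componentwise_UNIV by blast
  qed
  note tr = R.transport[OF vector_space_coord_smul lin bij cont]
  have "irreducible_representation G X coord_smul ?U ?\<tau>"
    by (rule irreducible_representation_equivalent[OF conjunct2[OF W] tr])
  then have U: "(?U, ?\<tau>) \<in> irreps G X" by (auto simp: irreps_def)
  then have "irrep_equiv G X `` {(?U, ?\<tau>)} \<in> dual_object G X"
    unfolding dual_object_def by (rule quotientI)
  moreover have "class_contains G smul W (restricted W) (irrep_equiv G X `` {(?U, ?\<tau>)})"
    unfolding class_contains_def
    using equiv_class_self[OF equiv_irrep_equiv U] tr(2) by blast
  ultimately show ?thesis using that by blast
qed

lemma trivial_class_in_dual_object: "trivial_class G X \<in> (dual_object G X :: ('g, 'k) coord_rep set set)"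
  unfolding trivial_class_def dual_object_def
  by (intro quotientI trivial_irrep group_G topspace_X)

lemma trivial_class_imp_invariant:
  assumes "invariant_subspace G smul V \<rho> W" "class_contains G smul W (restricted W) (trivial_class G X)"
  shows "W \<subseteq> invariant_vectors G V \<rho>"
proof -
  obtain U \<tau> where U: "((coord_space 1, \<lambda>g. \<lambda>x\<in>coord_space 1. x), (U, \<tau>)) \<in> irrep_equiv G X"
    and eq: "equivalent_representations G smul W (restricted W) coord_smul U (\<tau> :: 'g \<Rightarrow> (nat \<Rightarrow> 'k) \<Rightarrow> _)"
    using assms(2) by (auto simp: class_contains_def trivial_class_def)
  have "fd_representation G X coord_smul (coord_space 1 :: (nat \<Rightarrow> 'k) set) (\<lambda>g. \<lambda>x\<in>coord_space 1. x)"
    and eq': "equivalent_representations G coord_smul (coord_space 1) (\<lambda>g. \<lambda>x\<in>coord_space 1. x) coord_smul U \<tau>"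
    using U by (auto simp: irrep_equiv_def irreps_def irreducible_representation_def)
  \<comment> \<open>The representative \<open>(U, \<tau>)\<close> is arbitrary, so the equivalence
    is continued to the standard trivial representation, where the action is the identity;
    injectivity of \<open>f\<close> pulls this back to \<open>W\<close>.\<close>
  from equivalent_representations_trans[OF eq equivalent_representations_sym[OF this]]
  obtain f :: "'v \<Rightarrow> nat \<Rightarrow> 'k" where f: "bij_betw f W (coord_space 1)"
    "\<And>g w. g \<in> carrier G \<Longrightarrow> w \<in> W \<Longrightarrow> f (restricted W g w) = (\<lambda>x\<in>coord_space 1. x) (f w)"
    unfolding equivalent_representations_def by blast
  show ?thesis
  proof
    fix w assume w: "w \<in> W"
    have "\<rho> g w = w" if g: "g \<in> carrier G" for g
    proof -
      have gw: "\<rho> g w \<in> W" by (rule invariant_subspaceD(3)[OF assms(1) g w])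
      have "f w \<in> coord_space 1" using f(1) w by (auto simp: bij_betw_def)
      then have "f (\<rho> g w) = f w" using f(2)[OF g w] w by simp
      then show ?thesis using f(1) w gw by (auto simp: bij_betw_def inj_on_def)
    qed
    then show "w \<in> invariant_vectors G V \<rho>"
      using w invariant_subspaceD(2)[OF assms(1)] by (auto simp: invariant_vectors_def)
  qed
qed

text \<open>Every line in \<open>W\<close> is invariant because \<open>W\<close> is fixed pointwise,
  so irreducibility forces \<open>W\<close> to be a line. Its coordinate map is then an equivalence
  with the trivial representation.\<close>

lemma invariant_imp_trivial_class:
  assumes W: "irreducible_subspace G X smul V \<rho> W" and inv: "W \<subseteq> invariant_vectors G V \<rho>"
  shows "class_contains G smul W (restricted W) (trivial_class G X)"
proof -
  note S = invariant_subspaceD[OF conjunct1[OF W]]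
  obtain w where w: "w \<in> W" "w \<noteq> 0"
    using W subspace_0[OF S(1)] unfolding irreducible_subspace_iff by blast
  have "span {w} \<subseteq> W" using w S(1) by (intro span_minimal) auto
  moreover from this have "invariant_subspace G smul V \<rho> (span {w})"
    using inv S(2) by (force simp: invariant_subspace_def invariant_vectors_def)
  moreover have "span {w} \<noteq> {0}" using w span_base[of w "{w}"] by auto
  ultimately have Ww: "W = span {w}" using W unfolding irreducible_subspace_iff by blast
  obtain \<phi> where \<phi>: "Vector_Spaces.linear smul coord_smul \<phi>"
    and bij: "bij_betw \<phi> W (coord_space 1)"
    using exists_coordinates[OF vector_space_axioms, of "{w}"] w(2) Ww by auto
  interpret \<phi>: Vector_Spaces.linear smul coord_smul \<phi> by fact
  have im: "\<phi> v \<in> coord_space 1" if "v \<in> W" for v using that bij by (auto simp: bij_betw_def)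
  have "linear_map_on smul W coord_smul (coord_space 1) \<phi>"
    using im by (auto simp: linear_map_on_def \<phi>.add \<phi>.scale)
  moreover have "\<phi> (restricted W g v) = (\<lambda>x\<in>coord_space 1. x) (\<phi> v)" if "g \<in> carrier G" "v \<in> W" for g v
    using that inv im by (auto simp: invariant_vectors_def)
  ultimately have "equivalent_representations G smul W (restricted W)
      coord_smul (coord_space 1) (\<lambda>g. \<lambda>x\<in>coord_space 1. x)"
    unfolding equivalent_representations_def using bij by blast
  moreover have "(coord_space 1, \<lambda>g. \<lambda>x\<in>coord_space 1. x) \<in> (trivial_class G X :: ('g, 'k) coord_rep set)"
    unfolding trivial_class_def
    by (intro equiv_class_self[OF equiv_irrep_equiv] trivial_irrep group_G topspace_X)
  ultimately show ?thesis unfolding class_contains_def by blast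
qed

text \<open>The inclusion that needs a construction is from right to left: a nonzero invariant
  vector spans an invariant line, which is irreducible and belongs to the trivial class.\<close>

lemma isotypic_component_trivial_class:
  "isotypic_component G X smul V \<rho> (trivial_class G X) = invariant_vectors G V \<rho>"
proof
  show "isotypic_component G X smul V \<rho> (trivial_class G X) \<subseteq> invariant_vectors G V \<rho>"
    unfolding isotypic_component_eq
  proof (intro span_minimal invariant_subspaceD(1)[OF invariant_subspace_invariant_vectors]
      Union_least)
    fix W assume "W \<in> {W. irreducible_subspace G X smul V \<rho> W \<and>
      class_contains G smul W (restricted W) (trivial_class G X)}"
    then show "W \<subseteq> invariant_vectors G V \<rho>"
      using trivial_class_imp_invariant by blast
  qed
next
  show "invariant_vectors G V \<rho> \<subseteq> isotypic_component G X smul V \<rho> (trivial_class G X)"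
  proof
    fix v assume v: "v \<in> invariant_vectors G V \<rho>"
    note I = invariant_subspaceD[OF invariant_subspace_invariant_vectors]
    show "v \<in> isotypic_component G X smul V \<rho> (trivial_class G X)"
    \<comment> \<open>The zero vector is separate, as \<open>{0}\<close> does not count as
      irreducible.\<close>
    proof (cases "v = 0")
      case True
      then show ?thesis
        using subspace_0 invariant_subspaceD(1)[OF invariant_subspace_isotypic_component] by blast
    next
      case False
      have sub: "span {v} \<subseteq> invariant_vectors G V \<rho>" using v I(1) by (intro span_minimal) auto
      then have "invariant_subspace G smul V \<rho> (span {v})"
        by (force simp: invariant_subspace_def invariant_vectors_def)
      moreover have "span {v} \<noteq> {0}" using False span_base[of v "{v}"] by auto
      moreover have "W = span {v}"
        if W: "invariant_subspace G smul V \<rho> W" "W \<subseteq> span {v}" "W \<noteq> {0}" for W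
      proof -
        obtain w where w: "w \<in> W" "w \<noteq> 0"
          using W(3) subspace_0[OF invariant_subspaceD(1)[OF W(1)]] by blast
        then obtain c where c: "w = smul c v" using W(2) by (auto simp: span_singleton)
        then have "v = smul (inverse c) w" using w(2) by auto
        then have "v \<in> W" using subspace_scale[OF invariant_subspaceD(1)[OF W(1)] w(1)] by metis
        then show ?thesis
          using W(2) span_minimal[of "{v}" W] invariant_subspaceD(1)[OF W(1)] by auto
      qed
      ultimately have irr: "irreducible_subspace G X smul V \<rho> (span {v})"
        unfolding irreducible_subspace_iff by blast
      then have "span {v} \<subseteq> isotypic_component G X smul V \<rho> (trivial_class G X)"
        unfolding isotypic_component_eq using invariant_imp_trivial_class[OF irr sub]
        by (intro order_trans[OF _ span_superset] Union_upper) simp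
      then show ?thesis using span_base[of v "{v}"] by auto
    qed
  qed
qed

text \<open>Were the projection zero on all members of \<open>\<W>\<close>, its kernel, being a
  subspace, would contain their span and with it \<open>W\<close>, which the projection fixes
  pointwise and which is not zero.\<close>

lemma irreducible_subspace_of_span:
  assumes W: "irreducible_subspace G X smul V \<rho> W" "W \<subseteq> span (\<Union>\<W>)"
    and \<W>: "\<And>U. U \<in> \<W> \<Longrightarrow> irreducible_subspace G X smul V \<rho> U"
  obtains U where "U \<in> \<W>" "equivalent_representations G smul U (restricted U) smul W (restricted W)"
proof -
  note S = invariant_subspaceD[OF conjunct1[OF W(1)]]
  obtain P where P: "linear_map_on smul V smul W P"
    "\<And>g v. g \<in> carrier G \<Longrightarrow> v \<in> V \<Longrightarrow> P (\<rho> g v) = \<rho> g (P v)" "\<And>w. w \<in> W \<Longrightarrow> P w = w"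
    using exists_equivariant_projection[OF conjunct1[OF W(1)]] by blast
  have "\<exists>U\<in>\<W>. \<exists>u\<in>U. P u \<noteq> 0"
  proof (rule ccontr)
    assume "\<not> ?thesis"
    then have zero: "P u = 0" if "u \<in> U" "U \<in> \<W>" for u U using that by blast
    have P0: "P 0 = 0"
      by (rule linear_map_on_zero[OF vector_space_axioms subspace_V vector_space_axioms P(1)])
    have "subspace {v \<in> V. P v = 0}"
      using P(1) P0 subspace_V
      by (auto intro!: subspaceI simp: linear_map_on_def subspace_0 subspace_add subspace_scale)
    moreover have "\<Union>\<W> \<subseteq> {v \<in> V. P v = 0}"
      using zero invariant_subspaceD(2)[OF conjunct1[OF \<W>]] by blast
    ultimately have "span (\<Union>\<W>) \<subseteq> {v \<in> V. P v = 0}" by (intro span_minimal)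
    then have sub0: "W \<subseteq> {0}" using W(2) P(3) by fastforce
    have "W \<noteq> {0}" using W(1) unfolding irreducible_subspace_iff by blast
    with sub0 show False using subspace_0[OF S(1)] by blast
  qed
  then obtain U u where U: "U \<in> \<W>" "u \<in> U" "P u \<noteq> 0" by blast
  show ?thesis
    by (rule that[OF U(1) schur[OF \<W>[OF U(1)] W(1) P(1,2) U(2,3)]])
qed

lemma isotypic_direct_sum:
  "is_direct_sum smul V (dual_object G X) (isotypic_component G X smul V \<rho>)"
proof (rule is_direct_sumI)
  let ?V = "isotypic_component G X smul V \<rho>"
  let ?\<W> = "\<lambda>c. {W. irreducible_subspace G X smul V \<rho> W \<and> class_contains G smul W (restricted W) c}"
  fix c :: "('g, 'k) coord_rep set" assume c: "c \<in> dual_object G X"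
  note I = invariant_subspace_isotypic_component
  show "subspace (?V c)" "?V c \<subseteq> V" by (rule invariant_subspaceD[OF I])+
  \<comment> \<open>Flattening a span of components to a span of irreducible subspaces brings the
    second factor of the intersection into the form that \<open>irreducible_subspace_of_span\<close>
    expects.\<close>
  have others: "span (\<Union>d\<in>dual_object G X - {c}. ?V d) \<subseteq> span (\<Union>(\<Union>d\<in>dual_object G X - {c}. ?\<W> d))"
    unfolding isotypic_component_eq by (intro span_minimal UN_least span_mono subspace_span) blast+
  have J: "invariant_subspace G smul V \<rho> (span (\<Union>d\<in>dual_object G X - {c}. ?V d))"
    using I by (intro invariant_subspace_span_Union) blast
  show "?V c \<inter> span (\<Union>d\<in>dual_object G X - {c}. ?V d) \<subseteq> {0}"
  proof (rule ccontr)
    assume "\<not> ?thesis"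
    then have "?V c \<inter> span (\<Union>d\<in>dual_object G X - {c}. ?V d) \<noteq> {0}" by blast
    from exists_irreducible_subspace[OF invariant_subspace_Int[OF I J] this]
    obtain W where W: "irreducible_subspace G X smul V \<rho> W"
      and "W \<subseteq> ?V c \<inter> span (\<Union>d\<in>dual_object G X - {c}. ?V d)" .
    then have sub: "W \<subseteq> ?V c" "W \<subseteq> span (\<Union>d\<in>dual_object G X - {c}. ?V d)" by simp_all
    obtain U where U: "U \<in> ?\<W> c"
      "equivalent_representations G smul U (restricted U) smul W (restricted W)"
      by (rule irreducible_subspace_of_span[OF W sub(1)[unfolded isotypic_component_eq]]) auto
    obtain U' where "U' \<in> (\<Union>d\<in>dual_object G X - {c}. ?\<W> d)"
      and eq: "equivalent_representations G smul U' (restricted U') smul W (restricted W)"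
      by (rule irreducible_subspace_of_span[OF W order_trans[OF sub(2) others]]) auto
    then obtain d where d: "d \<in> dual_object G X" "d \<noteq> c" and U': "U' \<in> ?\<W> d" by blast
    have fd: "fd_representation G X smul U (restricted U)" "fd_representation G X smul U' (restricted U')"
      using U(1) U' subrepresentation by auto
    have "equivalent_representations G smul U (restricted U) smul U' (restricted U')"
      by (rule equivalent_representations_trans[OF U(2) equivalent_representations_sym[OF fd(2) eq]])
    then have "c = d" using U(1) U' by (intro dual_object_class_unique[OF c _ d(1) _ fd(1)]) auto
    with d(2) show False by blast
  qed
next
  \<comment> \<open>The irreducible subspaces already span \<open>V\<close>, so it is enough to find
    each of them inside some component.\<close>
  have "span (\<Union>{W. irreducible_subspace G X smul V \<rho> W}) \<subseteq>
      span (\<Union>c\<in>dual_object G X. isotypic_component G X smul V \<rho> c)"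
  proof (rule span_mono, rule Union_least)
    fix W assume "W \<in> {W. irreducible_subspace G X smul V \<rho> W}"
    then have W: "irreducible_subspace G X smul V \<rho> W" by simp
    obtain c where c: "c \<in> dual_object G X" "class_contains G smul W (restricted W) c"
      by (rule exists_class[OF W])
    have "W \<subseteq> isotypic_component G X smul V \<rho> c"
      unfolding isotypic_component_eq using W c(2)
      by (intro order_trans[OF _ span_superset] Union_upper) simp
    then show "W \<subseteq> (\<Union>c\<in>dual_object G X. isotypic_component G X smul V \<rho> c)" using c(1) by blast
  qed
  then show "V \<subseteq> span (\<Union>c\<in>dual_object G X. isotypic_component G X smul V \<rho> c)"
    by (simp only: span_irreducible_subspaces)
qed

section \<open>The averaging operator\<close>

lemma averaging_in_invariant_subspace:
  assumes "invariant_subspace G smul V \<rho> U" "v \<in> U"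
  shows "averaging_operator \<mu> \<rho> v \<in> U"
  unfolding averaging_operator_def using invariant_subspaceD[OF assms(1)] assms(2)
  by (intro integral_in_subspace continuous_orbit) auto

lemma integrable_orbit: "v \<in> V \<Longrightarrow> integrable \<mu> (\<lambda>g. \<rho> g v)"
  by (intro integrable_continuous continuous_orbit)

lemma linear_averaging: "linear_map_on smul V smul V (averaging_operator \<mu> \<rho>)"
proof -
  have "averaging_operator \<mu> \<rho> (u + v) = averaging_operator \<mu> \<rho> u + averaging_operator \<mu> \<rho> v"
    if "u \<in> V" "v \<in> V" for u v
  proof -
    have "averaging_operator \<mu> \<rho> (u + v) = (\<integral>g. \<rho> g u + \<rho> g v \<partial>\<mu>)"
      unfolding averaging_operator_def using that
      by (intro Bochner_Integration.integral_cong) (auto simp: space_haar action_add)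
    then show ?thesis using integrable_orbit that by (simp add: averaging_operator_def)
  qed
  moreover have "averaging_operator \<mu> \<rho> (smul c v) = smul c (averaging_operator \<mu> \<rho> v)"
    if "v \<in> V" for c v
  proof -
    have "averaging_operator \<mu> \<rho> (smul c v) = (\<integral>g. smul c (\<rho> g v) \<partial>\<mu>)"
      unfolding averaging_operator_def using that
      by (intro Bochner_Integration.integral_cong) (auto simp: space_haar action_scale)
    then show ?thesis
      using integral_bounded_linear[OF bounded_linear_smul integrable_orbit[OF that]]
      by (simp add: averaging_operator_def)
  qed
  ultimately show ?thesis
    using averaging_in_invariant_subspace[OF invariant_subspace_V] by (simp add: linear_map_on_def)
qed

text \<open>Under the integral sign \<open>\<rho> h\<close> turns \<open>g\<close> into
  \<open>h \<otimes> g\<close>, and left invariance of the measure absorbs the shift.\<close>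

lemma averaging_invariant:
  assumes v: "v \<in> V"
  shows "averaging_operator \<mu> \<rho> v \<in> invariant_vectors G V \<rho>"
proof -
  have "\<rho> h (averaging_operator \<mu> \<rho> v) = averaging_operator \<mu> \<rho> v" if h: "h \<in> carrier G" for h
  proof -
    have "\<rho> h (averaging_operator \<mu> \<rho> v) = (\<integral>g. \<rho> h (\<rho> g v) \<partial>\<mu>)"
      unfolding averaging_operator_def by (intro action_integral h continuous_orbit action_closed v)
    also have "\<dots> = (\<integral>g. \<rho> (h \<otimes> g) v \<partial>\<mu>)"
      using h v by (intro Bochner_Integration.integral_cong) (auto simp: space_haar composition_rule)
    also have "\<dots> = averaging_operator \<mu> \<rho> v"
      unfolding averaging_operator_def by (intro integral_left_translation h continuous_orbit v)
    finally show ?thesis .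
  qed
  then show ?thesis
    using averaging_in_invariant_subspace[OF invariant_subspace_V v] by (simp add: invariant_vectors_def)
qed

lemma averaging_fixes_invariants:
  assumes "v \<in> invariant_vectors G V \<rho>"
  shows "averaging_operator \<mu> \<rho> v = v"
proof -
  have "averaging_operator \<mu> \<rho> v = (\<integral>g. v \<partial>\<mu>)"
    unfolding averaging_operator_def using assms
    by (intro Bochner_Integration.integral_cong) (auto simp: space_haar invariant_vectors_def)
  then show ?thesis by (simp only: integral_constant)
qed

lemma averaging_image: "averaging_operator \<mu> \<rho> ` V = invariant_vectors G V \<rho>"
proof
  show "averaging_operator \<mu> \<rho> ` V \<subseteq> invariant_vectors G V \<rho>"
    using averaging_invariant by blast
  show "invariant_vectors G V \<rho> \<subseteq> averaging_operator \<mu> \<rho> ` V"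
  proof
    fix v assume v: "v \<in> invariant_vectors G V \<rho>"
    then have "v \<in> V" by (simp add: invariant_vectors_def)
    then show "v \<in> averaging_operator \<mu> \<rho> ` V"
      using averaging_fixes_invariants[OF v] by (metis imageI)
  qed
qed

lemma averaging_vanishes:
  assumes c: "c \<in> dual_object G X" "c \<noteq> trivial_class G X"
    and v: "v \<in> isotypic_component G X smul V \<rho> c"
  shows "averaging_operator \<mu> \<rho> v = 0"
proof -
  let ?T = "averaging_operator \<mu> \<rho>"
  have T0: "?T 0 = 0"
    by (rule linear_map_on_zero[OF vector_space_axioms subspace_V vector_space_axioms linear_averaging])
  \<comment> \<open>As the kernel is a subspace, it suffices to treat the irreducible subspaces that
    generate the component.\<close>
  have K: "subspace {v \<in> V. ?T v = 0}"
    using linear_averaging T0 subspace_V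
    by (auto intro!: subspaceI simp: linear_map_on_def subspace_0 subspace_add subspace_scale)
  have "W \<subseteq> {v \<in> V. ?T v = 0}"
    if W: "irreducible_subspace G X smul V \<rho> W" and Wc: "class_contains G smul W (restricted W) c" for W
  proof -
    let ?I = "W \<inter> invariant_vectors G V \<rho>"
    have inv: "invariant_subspace G smul V \<rho> ?I"
      by (rule invariant_subspace_Int[OF conjunct1[OF W] invariant_subspace_invariant_vectors])
    \<comment> \<open>Equality would put \<open>W\<close> into the trivial class as well as into
      \<open>c\<close>, and a representation belongs to one class only.\<close>
    have "?I \<noteq> W"
    proof
      assume "?I = W"
      then have "class_contains G smul W (restricted W) (trivial_class G X)"
        using invariant_imp_trivial_class[OF W] by blast
      then have "c = trivial_class G X"
        by (rule dual_object_class_unique[OF c(1) Wc trivial_class_in_dual_object _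
              subrepresentation[OF conjunct1[OF W]] equivalent_representations_refl])
      with c(2) show False by blast
    qed
    then have I: "?I = {0}" using W inv unfolding irreducible_subspace_iff by blast
    have WV: "W \<subseteq> V" by (rule invariant_subspaceD(2)[OF conjunct1[OF W]])
    show ?thesis
    proof
      fix w assume w: "w \<in> W"
      then have "?T w \<in> ?I"
        using averaging_in_invariant_subspace[OF conjunct1[OF W]] averaging_invariant WV by blast
      then show "w \<in> {v \<in> V. ?T v = 0}" using I w WV by blast
    qed
  qed
  then have "isotypic_component G X smul V \<rho> c \<subseteq> {v \<in> V. ?T v = 0}"
    unfolding isotypic_component_eq by (intro span_minimal K) blast
  then show ?thesis using v by blast
qed

end

text \<open>The Bochner integral is 0 by convention on functions that are not integrable, so
  integrability of the orbit maps is part of the claim. Linearity, the image and the action on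
  invariants say that the operator is a projection; the last clause and the direct sum determine its
  kernel.\<close>

theorem corollary4p3:
  fixes G :: "('g, 'm) monoid_scheme"
    and X :: "'g topology" and n :: nat and \<A> :: "'g chart set"
    and \<mu> :: "'g measure"
    and smul :: "'k::real_normed_field \<Rightarrow> 'v::euclidean_space \<Rightarrow> 'v"
    and V :: "'v set" and \<rho> :: "'g \<Rightarrow> 'v \<Rightarrow> 'v"
  assumes "lie_group G X n \<A>" and "compact_space X" and "connected_space X"
    and "normalized_haar_measure G X \<mu>"
    and "\<And>r v. smul (of_real r) v = r *\<^sub>R v"
    and "fd_representation G X smul V \<rho>"
  shows "(\<forall>v\<in>V. integrable \<mu> (\<lambda>g. \<rho> g v)) \<and>
    is_direct_sum smul V (dual_object G X) (isotypic_component G X smul V \<rho>) \<and>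
    trivial_class G X \<in> (dual_object G X :: ('g, 'k) coord_rep set set) \<and>
    isotypic_component G X smul V \<rho> (trivial_class G X) = invariant_vectors G V \<rho> \<and>
    linear_map_on smul V smul V (averaging_operator \<mu> \<rho>) \<and>
    averaging_operator \<mu> \<rho> ` V = invariant_vectors G V \<rho> \<and>
    (\<forall>v\<in>invariant_vectors G V \<rho>. averaging_operator \<mu> \<rho> v = v) \<and>
    (\<forall>c\<in>dual_object G X - {trivial_class G X}.
       \<forall>v\<in>isotypic_component G X smul V \<rho> c. averaging_operator \<mu> \<rho> v = 0)"
proof -
  interpret lie_group G X n \<A> by fact
  \<comment> \<open>Continuity of multiplication and inversion is the first conjunct of
    \<open>smooth_map\<close>.\<close>
  have "compact_group_representation G X smul V \<rho> \<mu>"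
    using assms(2,4-6) topspace_eq smooth_mult smooth_inv
    by (intro compact_group_representation.intro compact_group_representation_axioms.intro)
      (auto simp: smooth_map_def)
  then interpret compact_group_representation G X smul V \<rho> \<mu> .
  show ?thesis
    by (intro conjI ballI integrable_orbit isotypic_direct_sum trivial_class_in_dual_object
        isotypic_component_trivial_class linear_averaging averaging_image
        averaging_fixes_invariants averaging_vanishes) auto
qed

end
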